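(* Let $\mathbb{C}$ be a ribbon category and $A$ a reflexive object of $\mathbb{C}$ (with isomorphism $\varphi:A\otimes A^*\to A$), and suppose $\mathrm{Tr}^A_{I,I}(\mathrm{id}_A)=\mathrm{id}_I$. Then the assignment $A^{\otimes m}\mapsto m$, $f\mapsto F(f)$ is a functor $F:\mathbb{C}|_A\to\mathcal{I}_{\mathcal{A}}$ which is full and faithful and gives an equivalence between $\mathbb{C}|_A$ and $\mathcal{I}_{\mathcal{A}}$.
   Context: Ribbon category: a (strict) braided monoidal category with braid $\sigma_{X,Y}:X\otimes Y\to Y\otimes X$, natural twist isomorphism $\theta$ with $\theta_{X\otimes Y}=\sigma_{X,Y};(\theta_Y\otimes\theta_X);\sigma_{Y,X}$, every object $X$ having a chosen left dual $X^*$ with unit $\eta_X:I\to X\otimes X^*$, counit $\varepsilon_X:X^*\otimes X\to I$ satisfying the snake equations, and $(\theta_X)^*=\theta_{X^*}$; composition $f;g$ is diagrammatic ($f$ first). Trace: $\mathrm{Tr}^X_{U,V}(f)=(U\otimes\eta_X);(f\otimes X^* );(V\otimes(\sigma_{X,X^*};(X^*\otimes\theta_X);\varepsilon_X))$ for $f:U\otimes X\to V\otimes X$. A reflexive object is an object $A$ with an isomorphism $\varphi:A\otimes A^*\to A$. $\mathbb{C}|_A$ is the full subcategory on the objects $A^{\otimes m}$, $m\ge 0$. Define $\mathbf{app}:=(\varphi^{-1}\otimes A);(A\otimes\varepsilon_A):A\otimes A\to A$; $\mathbf{lam}:=(A\otimes\eta_A);(A\otimes A\otimes\theta_{A^*}^{-1});(A\otimes\sigma^{-1}_{A^*,A});(\varphi\otimes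 A):A\to A\otimes A$; $\mathbf{app}_0=\mathrm{id}_A$, $\mathbf{app}_{n+1}=(\mathbf{app}\otimes A^{\otimes n});\mathbf{app}_n:A^{\otimes(n+2)}\to A$; $\mathbf{lam}_0=\mathrm{id}_A$, $\mathbf{lam}_{m+1}=\mathbf{lam}_m;(\mathbf{lam}\otimes A^{\otimes m}):A\to A^{\otimes(m+2)}$; for $f:A^{\otimes m}\to A^{\otimes n}$, $F(f):=\mathrm{Tr}^A_{I,A}(\mathbf{lam}_m;(\mathbf{lam}\otimes f);(A\otimes\mathbf{app}_n)):I\to A$. Let $\mathcal{A}=\mathbb{C}(I,A)$ with application $a\,b:=(a\otimes b);\mathbf{app}$ (left-associative), and elements $\mathbf{B}:=F(\mathbf{app})$, $\mathbf{C}^+:=F(\sigma_{A,A})$, $\mathbf{I}:=F(\mathrm{id}_I)$. Write $a\circ b:=\mathbf{B}\,a\,b$, $a^0:=\mathbf{I}$, $a^{n+1}:=a\circ a^n$, $a^\bullet:=\mathbf{C}^+\,\mathbf{I}\,a$; $a$ has arity $m\to n$ if $a^\bullet\circ\mathbf{B}^{m+1}=(\mathbf{B}\,a)\circ\mathbf{B}^n$. The internal PROB $\mathcal{I}_{\mathcal{A}}$ is the category whose objects are the natural numbers, whose morphisms $m\to n$ are the elements of arity $m\to n$, with composite of $a:l\to m$ and $b:m\to n$ equal to $a\circ b$ and identities $\mathbf{I}$. *)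

theory Defs
  imports Main
begin

section \<open>Categories, functors, equivalences\<close>

text \<open>
  Composition \<open>f ;; g\<close> is diagrammatic (\<open>f\<close> first). Hom-sets are not required to be
  disjoint: an element of an applicative structure may have several arities, so the internal
  PROB below has overlapping hom-sets. Consequently the arrow part of a functor takes the source
  and target objects as arguments.
\<close>

record ('o, 'm) cat =
  obj :: "'o set"
  hom :: "'o \<Rightarrow> 'o \<Rightarrow> 'm set"
  ident :: "'o \<Rightarrow> 'm" ("\<one>\<index>")
  seq :: "'m \<Rightarrow> 'm \<Rightarrow> 'm" (infixl ";;\<index>" 60)

locale category =
  fixes C :: "('o, 'm, 'z) cat_scheme" (structure)
  assumes ident_hom: "X \<in> obj C \<Longrightarrow> \<one> X \<in> hom C X X"
    and seq_hom: "\<lbrakk>X \<in> obj C; Y \<in> obj C; Z \<in> obj C; f \<in> hom C X Y; g \<in> hom C Y Z\<rbrakk>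
      \<Longrightarrow> f ;; g \<in> hom C X Z"
    and ident_seq: "\<lbrakk>X \<in> obj C; Y \<in> obj C; f \<in> hom C X Y\<rbrakk> \<Longrightarrow> \<one> X ;; f = f"
    and seq_ident: "\<lbrakk>X \<in> obj C; Y \<in> obj C; f \<in> hom C X Y\<rbrakk> \<Longrightarrow> f ;; \<one> Y = f"
    and seq_assoc: "\<lbrakk>W \<in> obj C; X \<in> obj C; Y \<in> obj C; Z \<in> obj C;
        f \<in> hom C W X; g \<in> hom C X Y; h \<in> hom C Y Z\<rbrakk>
      \<Longrightarrow> (f ;; g) ;; h = f ;; (g ;; h)"

definition inverse_arrows ::
    "('o, 'm, 'z) cat_scheme \<Rightarrow> 'o \<Rightarrow> 'o \<Rightarrow> 'm \<Rightarrow> 'm \<Rightarrow> bool" where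
  "inverse_arrows C X Y f g \<longleftrightarrow>
     f \<in> hom C X Y \<and> g \<in> hom C Y X \<and> seq C f g = ident C X \<and> seq C g f = ident C Y"

definition is_iso :: "('o, 'm, 'z) cat_scheme \<Rightarrow> 'o \<Rightarrow> 'o \<Rightarrow> 'm \<Rightarrow> bool" where
  "is_iso C X Y f \<longleftrightarrow> (\<exists>g. inverse_arrows C X Y f g)"

definition inv_arr :: "('o, 'm, 'z) cat_scheme \<Rightarrow> 'o \<Rightarrow> 'o \<Rightarrow> 'm \<Rightarrow> 'm" where
  "inv_arr C X Y f = (THE g. inverse_arrows C X Y f g)"

definition is_functor :: "('o, 'm, 'y) cat_scheme \<Rightarrow> ('p, 'n, 'z) cat_scheme \<Rightarrow>
    ('o \<Rightarrow> 'p) \<Rightarrow> ('o \<Rightarrow> 'o \<Rightarrow> 'm \<Rightarrow> 'n) \<Rightarrow> bool" where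
  "is_functor C D Fo Fa \<longleftrightarrow>
     category C \<and> category D \<and>
     (\<forall>X \<in> obj C. Fo X \<in> obj D) \<and>
     (\<forall>X \<in> obj C. \<forall>Y \<in> obj C. \<forall>f \<in> hom C X Y. Fa X Y f \<in> hom D (Fo X) (Fo Y)) \<and>
     (\<forall>X \<in> obj C. Fa X X (ident C X) = ident D (Fo X)) \<and>
     (\<forall>X \<in> obj C. \<forall>Y \<in> obj C. \<forall>Z \<in> obj C. \<forall>f \<in> hom C X Y. \<forall>g \<in> hom C Y Z.
        Fa X Z (seq C f g) = seq D (Fa X Y f) (Fa Y Z g))"

definition is_full :: "('o, 'm, 'y) cat_scheme \<Rightarrow> ('p, 'n, 'z) cat_scheme \<Rightarrow>
    ('o \<Rightarrow> 'p) \<Rightarrow> ('o \<Rightarrow> 'o \<Rightarrow> 'm \<Rightarrow> 'n) \<Rightarrow> bool" where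
  "is_full C D Fo Fa \<longleftrightarrow>
     (\<forall>X \<in> obj C. \<forall>Y \<in> obj C. \<forall>g \<in> hom D (Fo X) (Fo Y). \<exists>f \<in> hom C X Y. Fa X Y f = g)"

definition is_faithful :: "('o, 'm, 'y) cat_scheme \<Rightarrow> ('o \<Rightarrow> 'o \<Rightarrow> 'm \<Rightarrow> 'n) \<Rightarrow> bool" where
  "is_faithful C Fa \<longleftrightarrow> (\<forall>X \<in> obj C. \<forall>Y \<in> obj C. inj_on (Fa X Y) (hom C X Y))"

definition is_nat_iso :: "('o, 'm, 'y) cat_scheme \<Rightarrow> ('p, 'n, 'z) cat_scheme \<Rightarrow>
    ('o \<Rightarrow> 'p) \<Rightarrow> ('o \<Rightarrow> 'o \<Rightarrow> 'm \<Rightarrow> 'n) \<Rightarrow>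
    ('o \<Rightarrow> 'p) \<Rightarrow> ('o \<Rightarrow> 'o \<Rightarrow> 'm \<Rightarrow> 'n) \<Rightarrow> ('o \<Rightarrow> 'n) \<Rightarrow> bool" where
  "is_nat_iso C D Fo Fa Go Ga \<tau> \<longleftrightarrow>
     (\<forall>X \<in> obj C. is_iso D (Fo X) (Go X) (\<tau> X)) \<and>
     (\<forall>X \<in> obj C. \<forall>Y \<in> obj C. \<forall>f \<in> hom C X Y.
        seq D (Fa X Y f) (\<tau> Y) = seq D (\<tau> X) (Ga X Y f))"

definition is_equivalence :: "('o, 'm, 'y) cat_scheme \<Rightarrow> ('p, 'n, 'z) cat_scheme \<Rightarrow>
    ('o \<Rightarrow> 'p) \<Rightarrow> ('o \<Rightarrow> 'o \<Rightarrow> 'm \<Rightarrow> 'n) \<Rightarrow> bool" where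
  "is_equivalence C D Fo Fa \<longleftrightarrow>
     is_functor C D Fo Fa \<and>
     (\<exists>Go Ga \<alpha> \<beta>. is_functor D C Go Ga \<and>
        is_nat_iso C C (\<lambda>X. X) (\<lambda>X Y f. f)
          (\<lambda>X. Go (Fo X)) (\<lambda>X Y f. Ga (Fo X) (Fo Y) (Fa X Y f)) \<alpha> \<and>
        is_nat_iso D D (\<lambda>U. Fo (Go U)) (\<lambda>U V g. Fa (Go U) (Go V) (Ga U V g))
          (\<lambda>U. U) (\<lambda>U V g. g) \<beta>)"

text \<open>
  The full subcategory on a family of objects, with the indices as objects: an index \<open>i\<close> stands
  for the object \<open>X i\<close>. Distinct indices remain distinct objects even if \<open>X\<close> takes the same
  value on them.
\<close>

definition full_subcat :: "('o, 'm, 'z) cat_scheme \<Rightarrow> ('i \<Rightarrow> 'o) \<Rightarrow> ('i, 'm) cat" where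
  "full_subcat C X =
     \<lparr>obj = UNIV, hom = (\<lambda>i j. hom C (X i) (X j)), ident = (\<lambda>i. ident C (X i)), seq = seq C\<rparr>"


section \<open>Strict ribbon categories\<close>

record ('o, 'm) ribbon = "('o, 'm) cat" +
  tunit :: 'o ("\<I>\<index>")
  tobj :: "'o \<Rightarrow> 'o \<Rightarrow> 'o" (infixr "\<odot>\<index>" 75)
  tarr :: "'m \<Rightarrow> 'm \<Rightarrow> 'm" (infixr "\<otimes>\<index>" 70)
  braid :: "'o \<Rightarrow> 'o \<Rightarrow> 'm" ("\<sigma>\<index>")
  twist :: "'o \<Rightarrow> 'm" ("\<theta>\<index>")
  dual :: "'o \<Rightarrow> 'o" ("_\<^sup>\<star>\<index>" [100] 100)
  coev :: "'o \<Rightarrow> 'm" ("\<eta>\<index>")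
  ev :: "'o \<Rightarrow> 'm" ("\<epsilon>\<index>")

locale strict_monoidal_category = category C
  for C :: "('o, 'm, 'z) ribbon_scheme" (structure) +
  assumes tunit_obj: "\<I> \<in> obj C"
    and tobj_obj: "\<lbrakk>X \<in> obj C; Y \<in> obj C\<rbrakk> \<Longrightarrow> X \<odot> Y \<in> obj C"
    and tarr_hom: "\<lbrakk>X \<in> obj C; Y \<in> obj C; X' \<in> obj C; Y' \<in> obj C;
        f \<in> hom C X Y; g \<in> hom C X' Y'\<rbrakk> \<Longrightarrow> f \<otimes> g \<in> hom C (X \<odot> X') (Y \<odot> Y')"
    and tarr_ident: "\<lbrakk>X \<in> obj C; Y \<in> obj C\<rbrakk> \<Longrightarrow> \<one> X \<otimes> \<one> Y = \<one> (X \<odot> Y)"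
    and tarr_seq: "\<lbrakk>X \<in> obj C; Y \<in> obj C; Z \<in> obj C; X' \<in> obj C; Y' \<in> obj C; Z' \<in> obj C;
        f \<in> hom C X Y; g \<in> hom C Y Z; f' \<in> hom C X' Y'; g' \<in> hom C Y' Z'\<rbrakk>
      \<Longrightarrow> (f ;; g) \<otimes> (f' ;; g') = (f \<otimes> f') ;; (g \<otimes> g')"
    and tobj_assoc: "\<lbrakk>X \<in> obj C; Y \<in> obj C; Z \<in> obj C\<rbrakk> \<Longrightarrow> (X \<odot> Y) \<odot> Z = X \<odot> (Y \<odot> Z)"
    and tobj_unit_left: "X \<in> obj C \<Longrightarrow> \<I> \<odot> X = X"
    and tobj_unit_right: "X \<in> obj C \<Longrightarrow> X \<odot> \<I> = X"
    and tarr_assoc: "\<lbrakk>X \<in> obj C; X' \<in> obj C; Y \<in> obj C; Y' \<in> obj C; Z \<in> obj C; Z' \<in> obj C;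
        f \<in> hom C X X'; g \<in> hom C Y Y'; h \<in> hom C Z Z'\<rbrakk>
      \<Longrightarrow> (f \<otimes> g) \<otimes> h = f \<otimes> (g \<otimes> h)"
    and tarr_unit_left: "\<lbrakk>X \<in> obj C; Y \<in> obj C; f \<in> hom C X Y\<rbrakk> \<Longrightarrow> \<one> \<I> \<otimes> f = f"
    and tarr_unit_right: "\<lbrakk>X \<in> obj C; Y \<in> obj C; f \<in> hom C X Y\<rbrakk> \<Longrightarrow> f \<otimes> \<one> \<I> = f"

locale strict_braided_category = strict_monoidal_category C
  for C :: "('o, 'm, 'z) ribbon_scheme" (structure) +
  assumes braid_iso: "\<lbrakk>X \<in> obj C; Y \<in> obj C\<rbrakk> \<Longrightarrow> is_iso C (X \<odot> Y) (Y \<odot> X) (\<sigma> X Y)"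
    and braid_natural: "\<lbrakk>X \<in> obj C; X' \<in> obj C; Y \<in> obj C; Y' \<in> obj C;
        f \<in> hom C X X'; g \<in> hom C Y Y'\<rbrakk>
      \<Longrightarrow> (f \<otimes> g) ;; \<sigma> X' Y' = \<sigma> X Y ;; (g \<otimes> f)"
    and hexagon1: "\<lbrakk>X \<in> obj C; Y \<in> obj C; Z \<in> obj C\<rbrakk>
      \<Longrightarrow> \<sigma> X (Y \<odot> Z) = (\<sigma> X Y \<otimes> \<one> Z) ;; (\<one> Y \<otimes> \<sigma> X Z)"
    and hexagon2: "\<lbrakk>X \<in> obj C; Y \<in> obj C; Z \<in> obj C\<rbrakk>
      \<Longrightarrow> \<sigma> (X \<odot> Y) Z = (\<one> X \<otimes> \<sigma> Y Z) ;; (\<sigma> X Z \<otimes> \<one> Y)"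

definition dual_arr :: "('o, 'm, 'z) ribbon_scheme \<Rightarrow> 'o \<Rightarrow> 'o \<Rightarrow> 'm \<Rightarrow> 'm" where
  "dual_arr C X Y f =
     (\<one>\<^bsub>C\<^esub> (Y\<^sup>\<star>\<^bsub>C\<^esub>) \<otimes>\<^bsub>C\<^esub> \<eta>\<^bsub>C\<^esub> X) ;;\<^bsub>C\<^esub>
     (\<one>\<^bsub>C\<^esub> (Y\<^sup>\<star>\<^bsub>C\<^esub>) \<otimes>\<^bsub>C\<^esub> f \<otimes>\<^bsub>C\<^esub> \<one>\<^bsub>C\<^esub> (X\<^sup>\<star>\<^bsub>C\<^esub>)) ;;\<^bsub>C\<^esub>
     (\<epsilon>\<^bsub>C\<^esub> Y \<otimes>\<^bsub>C\<^esub> \<one>\<^bsub>C\<^esub> (X\<^sup>\<star>\<^bsub>C\<^esub>))"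

locale ribbon_category = strict_braided_category C
  for C :: "('o, 'm, 'z) ribbon_scheme" (structure) +
  assumes dual_obj: "X \<in> obj C \<Longrightarrow> X\<^sup>\<star> \<in> obj C"
    and coev_hom: "X \<in> obj C \<Longrightarrow> \<eta> X \<in> hom C \<I> (X \<odot> X\<^sup>\<star>)"
    and ev_hom: "X \<in> obj C \<Longrightarrow> \<epsilon> X \<in> hom C (X\<^sup>\<star> \<odot> X) \<I>"
    and snake1: "X \<in> obj C \<Longrightarrow> (\<eta> X \<otimes> \<one> X) ;; (\<one> X \<otimes> \<epsilon> X) = \<one> X"
    and snake2: "X \<in> obj C \<Longrightarrow>
      (\<one> (X\<^sup>\<star>) \<otimes> \<eta> X) ;; (\<epsilon> X \<otimes> \<one> (X\<^sup>\<star>)) = \<one> (X\<^sup>\<star>)"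
    and twist_iso: "X \<in> obj C \<Longrightarrow> is_iso C X X (\<theta> X)"
    and twist_natural: "\<lbrakk>X \<in> obj C; Y \<in> obj C; f \<in> hom C X Y\<rbrakk> \<Longrightarrow> f ;; \<theta> Y = \<theta> X ;; f"
    and twist_tensor: "\<lbrakk>X \<in> obj C; Y \<in> obj C\<rbrakk>
      \<Longrightarrow> \<theta> (X \<odot> Y) = \<sigma> X Y ;; (\<theta> Y \<otimes> \<theta> X) ;; \<sigma> Y X"
    and twist_dual: "X \<in> obj C \<Longrightarrow> dual_arr C X X (\<theta> X) = \<theta> (X\<^sup>\<star>)"
begin

definition trace :: "'o \<Rightarrow> 'o \<Rightarrow> 'o \<Rightarrow> 'm \<Rightarrow> 'm" where
  "trace U V X f =
     (\<one> U \<otimes> \<eta> X) ;; (f \<otimes> \<one> (X\<^sup>\<star>)) ;;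
     (\<one> V \<otimes> (\<sigma> X (X\<^sup>\<star>) ;; (\<one> (X\<^sup>\<star>) \<otimes> \<theta> X) ;; \<epsilon> X))"

primrec tpow :: "'o \<Rightarrow> nat \<Rightarrow> 'o" where
  "tpow X 0 = \<I>"
| "tpow X (Suc n) = X \<odot> tpow X n"

end


section \<open>Reflexive objects and the internal PROB\<close>

locale reflexive_object = ribbon_category C
  for C :: "('o, 'm, 'z) ribbon_scheme" (structure) and A :: 'o and \<phi> :: 'm +
  assumes A_obj: "A \<in> obj C"
    and phi_iso: "is_iso C (A \<odot> A\<^sup>\<star>) A \<phi>"
begin

definition app :: 'm where
  "app = (inv_arr C (A \<odot> A\<^sup>\<star>) A \<phi> \<otimes> \<one> A) ;; (\<one> A \<otimes> \<epsilon> A)"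

definition lam :: 'm where
  "lam =
     (\<one> A \<otimes> \<eta> A) ;;
     (\<one> A \<otimes> \<one> A \<otimes> inv_arr C (A\<^sup>\<star>) (A\<^sup>\<star>) (\<theta> (A\<^sup>\<star>))) ;;
     (\<one> A \<otimes> inv_arr C (A\<^sup>\<star> \<odot> A) (A \<odot> A\<^sup>\<star>) (\<sigma> (A\<^sup>\<star>) A)) ;;
     (\<phi> \<otimes> \<one> A)"

primrec apps :: "nat \<Rightarrow> 'm" where
  "apps 0 = \<one> A"
| "apps (Suc n) = (app \<otimes> \<one> (tpow A n)) ;; apps n"

primrec lams :: "nat \<Rightarrow> 'm" where
  "lams 0 = \<one> A"
| "lams (Suc m) = lams m ;; (lam \<otimes> \<one> (tpow A m))"

definition F :: "nat \<Rightarrow> nat \<Rightarrow> 'm \<Rightarrow> 'm" where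
  "F m n f = trace \<I> A A (lams m ;; (lam \<otimes> f) ;; (\<one> A \<otimes> apps n))"

definition appl :: "'m \<Rightarrow> 'm \<Rightarrow> 'm" (infixl "\<bullet>" 80) where
  "a \<bullet> b = (a \<otimes> b) ;; app"

definition combB :: 'm where "combB = F 2 1 app"

definition combC :: 'm where "combC = F 2 2 (\<sigma> A A)"

definition combI :: 'm where "combI = F 0 0 (\<one> \<I>)"

definition compos :: "'m \<Rightarrow> 'm \<Rightarrow> 'm" where
  "compos a b = combB \<bullet> a \<bullet> b"

primrec iter :: "'m \<Rightarrow> nat \<Rightarrow> 'm" where
  "iter a 0 = combI"
| "iter a (Suc n) = compos a (iter a n)"

definition bul :: "'m \<Rightarrow> 'm" where
  "bul a = combC \<bullet> combI \<bullet> a"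

definition has_arity :: "'m \<Rightarrow> nat \<Rightarrow> nat \<Rightarrow> bool" where
  "has_arity a m n \<longleftrightarrow>
     compos (bul a) (iter combB (Suc m)) = compos (combB \<bullet> a) (iter combB n)"

definition internal_PROB :: "(nat, 'm) cat" where
  "internal_PROB =
     \<lparr>obj = UNIV, hom = (\<lambda>m n. {a \<in> hom C \<I> A. has_arity a m n}),
      ident = (\<lambda>n. combI), seq = compos\<rparr>"

text \<open>
  The subcategory on the tensor powers of \<open>A\<close>, where \<open>m\<close> represents the \<open>m\<close>-th tensor power.
  Since \<open>A\<^sup>\<otimes>\<^sup>m = A\<^sup>\<otimes>\<^sup>n\<close> may hold for \<open>m \<noteq> n\<close>, keeping the exponent as part of the object
  is what makes sending the \<open>m\<close>-th power to \<open>m\<close> well defined.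
\<close>

definition powers_subcat :: "(nat, 'm) cat" where
  "powers_subcat = full_subcat C (tpow A)"

end

end

theory Submission
  imports Defs
begin

text \<open>
  Write \<open>D = A\<^sup>\<star>\<close>. Since \<open>A \<odot> D \<cong> A\<close>, every arrow \<open>X \<odot> A\<^sup>\<otimes>\<^sup>k \<rightarrow> A\<close> is
  \<open>(h \<otimes> A\<^sup>\<otimes>\<^sup>k) ;; apps k\<close> for a unique \<open>h : X \<rightarrow> A\<close>, and \<open>app\<close> acts as an evaluation map. Unwinding
  the trace (this is where braids, twists and the pivotal structure are used) shows that \<open>F m n f\<close> is
  the curried form of \<open>(A \<otimes> f) ;; apps n\<close>. An element \<open>a\<close> is determined by its operator
  \<open>op a = (a \<otimes> A) ;; app\<close>; composition of elements becomes reversed composition of operators, which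
  gives functoriality. Having arity \<open>m \<rightarrow> n\<close> says that \<open>h = (a \<otimes> A\<^sup>\<otimes>\<^sup>m\<^sup>+\<^sup>1) ;; apps (m + 1)\<close> commutes with
  composition with an arbitrary element in the first argument. Because the loop on \<open>A\<close> has value 1, the counit
  \<open>D \<odot> A \<rightarrow> \<I>\<close> has a section. Hence \<open>A \<otimes> _\<close> is injective on arrows, which yields faithfulness,
  and the arity equation can be solved as \<open>h = (A \<otimes> f) ;; apps n\<close>, which yields fullness.
\<close>

section \<open>Functors that are the identity on objects\<close>

context category
begin

lemma inverse_arrows_unique:
  assumes "X \<in> obj C" "Y \<in> obj C" "inverse_arrows C X Y f g" "inverse_arrows C X Y f h"
  shows "g = h"
proof -
  have "g = (h ;; f) ;; g"
    using assms ident_seq[of Y X g] by (simp add: inverse_arrows_def)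
  also have "\<dots> = h ;; (f ;; g)"
    using assms seq_assoc[of Y X Y X h f g] by (simp add: inverse_arrows_def)
  also have "\<dots> = h"
    using assms seq_ident[of Y X h] by (simp add: inverse_arrows_def)
  finally show ?thesis .
qed

lemma inv_arr_inverse:
  assumes "X \<in> obj C" "Y \<in> obj C" "is_iso C X Y f"
  shows "inverse_arrows C X Y f (inv_arr C X Y f)"
proof -
  obtain g where g: "inverse_arrows C X Y f g"
    using assms(3) by (auto simp: is_iso_def)
  then have "inv_arr C X Y f = g"
    unfolding inv_arr_def using inverse_arrows_unique[OF assms(1,2)] by blast
  with g show ?thesis by simp
qed

end

text \<open>A functor that is the identity on objects needs no choice of objects for its inverse.
  The inverses of the bijections on hom-sets are already functorial, and both natural isomorphisms
  can have identity components.\<close>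

lemma identity_on_objects_equivalence:
  assumes F: "is_functor C D (\<lambda>X. X) Fa" and obj: "obj C = obj D"
    and full: "is_full C D (\<lambda>X. X) Fa" and faithful: "is_faithful C Fa"
  shows "is_equivalence C D (\<lambda>X. X) Fa"
proof -
  interpret C: category C using F by (simp add: is_functor_def)
  interpret D: category D using F by (simp add: is_functor_def)
  define G where "G X Y = inv_into (hom C X Y) (Fa X Y)" for X Y
  have Fa: "Fa X Y f \<in> hom D X Y" if "X \<in> obj C" "Y \<in> obj C" "f \<in> hom C X Y" for X Y f
    using F that by (auto simp: is_functor_def)
  have Fa_ident: "Fa X X (ident C X) = ident D X" if "X \<in> obj C" for X
    using F that by (auto simp: is_functor_def)
  have Fa_seq: "Fa X Z (seq C f g) = seq D (Fa X Y f) (Fa Y Z g)"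
    if "X \<in> obj C" "Y \<in> obj C" "Z \<in> obj C" "f \<in> hom C X Y" "g \<in> hom C Y Z" for X Y Z f g
    using F that by (auto simp: is_functor_def)
  have G_Fa: "G X Y (Fa X Y f) = f" if "X \<in> obj C" "Y \<in> obj C" "f \<in> hom C X Y" for X Y f
    using faithful that by (simp add: is_faithful_def G_def)
  have image: "Fa X Y ` hom C X Y = hom D X Y" if "X \<in> obj C" "Y \<in> obj C" for X Y
    using full that Fa by (fastforce simp: is_full_def)
  have Fa_G: "Fa X Y (G X Y g) = g" and G: "G X Y g \<in> hom C X Y"
    if "X \<in> obj C" "Y \<in> obj C" "g \<in> hom D X Y" for X Y g
    using that image[OF that(1,2)] by (auto simp: G_def f_inv_into_f inv_into_into)
  have G_functor: "is_functor D C (\<lambda>X. X) G"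
    unfolding is_functor_def
  proof (intro conjI ballI)
    fix X assume "X \<in> obj D"
    then show "G X X (ident D X) = ident C X"
      using obj G_Fa[of X X "ident C X"] Fa_ident[of X] C.ident_hom[of X] by simp
  next
    fix X Y Z f g
    assume XYZ: "X \<in> obj D" "Y \<in> obj D" "Z \<in> obj D" and f: "f \<in> hom D X Y" and g: "g \<in> hom D Y Z"
    have "seq C (G X Y f) (G Y Z g) \<in> hom C X Z"
      using XYZ f g obj G by (auto intro: C.seq_hom)
    then show "G X Z (seq D f g) = seq C (G X Y f) (G Y Z g)"
      using XYZ f g obj G Fa_G Fa_seq[of X Y Z "G X Y f" "G Y Z g"]
        G_Fa[of X Z "seq C (G X Y f) (G Y Z g)"] by simp
  qed (use obj G C.category_axioms D.category_axioms in auto)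
  have "is_nat_iso C C (\<lambda>X. X) (\<lambda>X Y f. f) (\<lambda>X. X) (\<lambda>X Y f. G X Y (Fa X Y f)) (ident C)"
    unfolding is_nat_iso_def is_iso_def inverse_arrows_def
    using C.ident_hom C.ident_seq C.seq_ident G_Fa by metis
  moreover have "is_nat_iso D D (\<lambda>X. X) (\<lambda>X Y f. Fa X Y (G X Y f)) (\<lambda>X. X) (\<lambda>X Y f. f) (ident D)"
    unfolding is_nat_iso_def is_iso_def inverse_arrows_def
    using D.ident_hom D.ident_seq D.seq_ident Fa_G obj by metis
  ultimately show ?thesis
    unfolding is_equivalence_def using F G_functor by blast
qed

section \<open>Whiskering calculus in strict monoidal categories\<close>

text \<open>
  Arrows bundled with source and target, so that the typing side conditions become equations
  that the simplifier can decide.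
\<close>

definition src :: "'o \<times> 'm \<times> 'o \<Rightarrow> 'o" where "src = fst"
definition tgt :: "'o \<times> 'm \<times> 'o \<Rightarrow> 'o" where "tgt = snd \<circ> snd"
definition mor :: "'o \<times> 'm \<times> 'o \<Rightarrow> 'm" where "mor = fst \<circ> snd"

lemma src_triple [simp]: "src (X, f, Y) = X"
  and tgt_triple [simp]: "tgt (X, f, Y) = Y"
  and mor_triple [simp]: "mor (X, f, Y) = f"
  by (simp_all add: src_def tgt_def mor_def)

lemma triple_eqI: "\<lbrakk>src f = src g; tgt f = tgt g; mor f = mor g\<rbrakk> \<Longrightarrow> f = g"
  by (cases f; cases g) simp

context strict_monoidal_category
begin

declare tunit_obj [simp] tobj_obj [simp] tobj_assoc [simp]
  tobj_unit_left [simp] tobj_unit_right [simp]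

definition arr :: "'o \<times> 'm \<times> 'o \<Rightarrow> bool" where
  "arr f \<longleftrightarrow> src f \<in> obj C \<and> tgt f \<in> obj C \<and> mor f \<in> hom C (src f) (tgt f)"

definition idt :: "'o \<Rightarrow> 'o \<times> 'm \<times> 'o" where
  "idt X = (X, \<one> X, X)"

definition comp :: "'o \<times> 'm \<times> 'o \<Rightarrow> 'o \<times> 'm \<times> 'o \<Rightarrow> 'o \<times> 'm \<times> 'o" (infixr "\<cdot>" 55) where
  "f \<cdot> g = (src f, mor f ;; mor g, tgt g)"

text \<open>
  Every composite of tensor products is rewritten into a composite of whiskered arrows
  \<open>X \<otimes> f \<otimes> Y\<close>; the only law not handled by this normal form is \<open>interchange\<close> below.
\<close>

definition W :: "'o \<Rightarrow> 'o \<times> 'm \<times> 'o \<Rightarrow> 'o \<Rightarrow> 'o \<times> 'm \<times> 'o" where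
  "W X f Y = (X \<odot> src f \<odot> Y, \<one> X \<otimes> mor f \<otimes> \<one> Y, X \<odot> tgt f \<odot> Y)"

lemma src_idt [simp]: "src (idt X) = X"
  and tgt_idt [simp]: "tgt (idt X) = X"
  and src_comp [simp]: "src (f \<cdot> g) = src f"
  and tgt_comp [simp]: "tgt (f \<cdot> g) = tgt g"
  and src_W [simp]: "src (W X f Y) = X \<odot> src f \<odot> Y"
  and tgt_W [simp]: "tgt (W X f Y) = X \<odot> tgt f \<odot> Y"
  by (simp_all add: idt_def comp_def W_def)

lemma arr_src: "arr f \<Longrightarrow> src f \<in> obj C"
  and arr_tgt: "arr f \<Longrightarrow> tgt f \<in> obj C"
  by (simp_all add: arr_def)

lemma arr_mor: "arr f \<Longrightarrow> mor f \<in> hom C (src f) (tgt f)"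
  by (simp add: arr_def)

lemma arr_triple: "arr (X, f, Y) \<longleftrightarrow> X \<in> obj C \<and> Y \<in> obj C \<and> f \<in> hom C X Y"
  by (simp add: arr_def)

lemma arr_idt [simp]: "X \<in> obj C \<Longrightarrow> arr (idt X)"
  by (simp add: arr_def idt_def ident_hom)

lemma arr_comp [simp]: "\<lbrakk>arr f; arr g; tgt f = src g\<rbrakk> \<Longrightarrow> arr (f \<cdot> g)"
  unfolding arr_def comp_def by (auto intro: seq_hom)

lemma arr_W [simp]: "\<lbrakk>arr f; X \<in> obj C; Y \<in> obj C\<rbrakk> \<Longrightarrow> arr (W X f Y)"
  unfolding arr_def W_def by (auto intro!: tarr_hom ident_hom)

lemma comp_assoc [simp]:
  "\<lbrakk>arr f; arr g; arr h; tgt f = src g; tgt g = src h\<rbrakk> \<Longrightarrow> (f \<cdot> g) \<cdot> h = f \<cdot> (g \<cdot> h)"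
  unfolding arr_def comp_def by (auto intro: seq_assoc)

lemma idt_comp [simp]: "\<lbrakk>arr f; src f = X\<rbrakk> \<Longrightarrow> idt X \<cdot> f = f"
  unfolding arr_def comp_def idt_def by (cases f) (auto intro: ident_seq)

lemma comp_idt [simp]: "\<lbrakk>arr f; tgt f = X\<rbrakk> \<Longrightarrow> f \<cdot> idt X = f"
  unfolding arr_def comp_def idt_def by (cases f) (auto intro: seq_ident)

declare arr_src [simp] arr_tgt [simp]

lemma W_idt [simp]: "\<lbrakk>X \<in> obj C; Y \<in> obj C; Z \<in> obj C\<rbrakk> \<Longrightarrow> W X (idt Z) Y = idt (X \<odot> Z \<odot> Y)"
  by (simp add: W_def idt_def tarr_ident)

lemma W_unit [simp]: "arr f \<Longrightarrow> W \<I> f \<I> = f"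
  using tarr_unit_left[of "src f" "tgt f" "mor f"] tarr_unit_right[of "src f" "tgt f" "mor f"]
  by (intro triple_eqI) (simp_all add: W_def arr_mor)

lemma W_comp [simp]:
  assumes "arr f" "arr g" "tgt f = src g" "X \<in> obj C" "Y \<in> obj C"
  shows "W X (f \<cdot> g) Y = W X f Y \<cdot> W X g Y"
proof -
  have f: "mor f \<in> hom C (src f) (src g)" and g: "mor g \<in> hom C (src g) (tgt g)"
    using assms arr_mor by (metis+)
  have "(mor f ;; mor g) \<otimes> (\<one> Y ;; \<one> Y) = (mor f \<otimes> \<one> Y) ;; (mor g \<otimes> \<one> Y)"
    using assms f g by (intro tarr_seq[of "src f" "src g" "tgt g" Y Y Y]) (auto intro: ident_hom)
  moreover have "(\<one> X ;; \<one> X) \<otimes> ((mor f \<otimes> \<one> Y) ;; (mor g \<otimes> \<one> Y))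
    = (\<one> X \<otimes> mor f \<otimes> \<one> Y) ;; (\<one> X \<otimes> mor g \<otimes> \<one> Y)"
    using assms f g
    by (intro tarr_seq[of X X X "src f \<odot> Y" "src g \<odot> Y" "tgt g \<odot> Y"])
      (auto intro!: ident_hom tarr_hom)
  moreover have "\<one> Z ;; \<one> Z = \<one> Z" if "Z \<in> obj C" for Z
    using that ident_hom ident_seq by blast
  ultimately show ?thesis
    using assms by (simp add: W_def comp_def)
qed

lemma W_W [simp]:
  assumes "arr f" "X \<in> obj C" "Y \<in> obj C" "X' \<in> obj C" "Y' \<in> obj C"
  shows "W X (W X' f Y') Y = W (X \<odot> X') f (Y' \<odot> Y)"
proof -
  let ?m = "mor f"
  have m: "?m \<in> hom C (src f) (tgt f)" using assms by (simp add: arr_mor)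
  have "(\<one> X' \<otimes> ?m \<otimes> \<one> Y') \<otimes> \<one> Y = \<one> X' \<otimes> (?m \<otimes> \<one> Y') \<otimes> \<one> Y"
    using assms m
    by (intro tarr_assoc[of X' X' "src f \<odot> Y'" "tgt f \<odot> Y'" Y Y]) (auto intro!: ident_hom tarr_hom)
  also have "(?m \<otimes> \<one> Y') \<otimes> \<one> Y = ?m \<otimes> \<one> Y' \<otimes> \<one> Y"
    using assms m
    by (intro tarr_assoc[of "src f" "tgt f" Y' Y' Y Y]) (auto intro!: ident_hom)
  also have "\<one> Y' \<otimes> \<one> Y = \<one> (Y' \<odot> Y)"
    using assms by (simp add: tarr_ident)
  finally have *: "(\<one> X' \<otimes> ?m \<otimes> \<one> Y') \<otimes> \<one> Y = \<one> X' \<otimes> ?m \<otimes> \<one> (Y' \<odot> Y)" .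
  have "\<one> X \<otimes> \<one> X' \<otimes> ?m \<otimes> \<one> (Y' \<odot> Y) = (\<one> X \<otimes> \<one> X') \<otimes> ?m \<otimes> \<one> (Y' \<odot> Y)"
    using assms m
    by (intro tarr_assoc[symmetric, of X X X' X' "src f \<odot> Y' \<odot> Y" "tgt f \<odot> Y' \<odot> Y"])
      (auto intro!: ident_hom tarr_hom)
  then show ?thesis
    using assms by (simp add: W_def * tarr_ident)
qed

text \<open>Bifunctoriality, with identities inserted on opposite sides of the two factors. That the
  two splittings agree is the source of \<open>interchange\<close>; taking \<open>W Y g \<I>\<close>
  as second factor there allows strands between the boxes.\<close>

lemma tensor_W:
  assumes "arr f" "arr g"
  shows "(src f \<odot> src g, mor f \<otimes> mor g, tgt f \<odot> tgt g) = W \<I> f (src g) \<cdot> W (tgt f) g \<I>"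
    and "(src f \<odot> src g, mor f \<otimes> mor g, tgt f \<odot> tgt g) = W (src f) g \<I> \<cdot> W \<I> f (tgt g)"
proof -
  have f: "mor f \<in> hom C (src f) (tgt f)" and g: "mor g \<in> hom C (src g) (tgt g)"
    using assms by (simp_all add: arr_mor)
  have ids: "\<one> \<I> \<otimes> mor f \<otimes> \<one> X = mor f \<otimes> \<one> X" "\<one> X \<otimes> mor g \<otimes> \<one> \<I> = \<one> X \<otimes> mor g"
    if "X \<in> obj C" for X
    using assms f g that tarr_unit_left[of "src f \<odot> X" "tgt f \<odot> X" "mor f \<otimes> \<one> X"]
      tarr_hom[of "src f" "tgt f" X X "mor f" "\<one> X"] tarr_unit_right[of "src g" "tgt g" "mor g"]
    by (auto simp: ident_hom)
  have units: "\<one> (src f) ;; mor f = mor f" "mor f ;; \<one> (tgt f) = mor f"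
    "\<one> (src g) ;; mor g = mor g" "mor g ;; \<one> (tgt g) = mor g"
    using arr_src[OF assms(1)] arr_tgt[OF assms(1)] arr_src[OF assms(2)] arr_tgt[OF assms(2)]
      f g ident_seq seq_ident by blast+
  have "(mor f ;; \<one> (tgt f)) \<otimes> (\<one> (src g) ;; mor g)
      = (mor f \<otimes> \<one> (src g)) ;; (\<one> (tgt f) \<otimes> mor g)"
    using assms f g
    by (intro tarr_seq[of "src f" "tgt f" "tgt f" "src g" "src g" "tgt g"]) (auto intro: ident_hom)
  then show "(src f \<odot> src g, mor f \<otimes> mor g, tgt f \<odot> tgt g) = W \<I> f (src g) \<cdot> W (tgt f) g \<I>"
    using assms by (simp add: W_def comp_def ids units)
  have "(\<one> (src f) ;; mor f) \<otimes> (mor g ;; \<one> (tgt g))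
      = (\<one> (src f) \<otimes> mor g) ;; (mor f \<otimes> \<one> (tgt g))"
    using assms f g
    by (intro tarr_seq[of "src f" "src f" "tgt f" "src g" "tgt g" "tgt g"]) (auto intro: ident_hom)
  then show "(src f \<odot> src g, mor f \<otimes> mor g, tgt f \<odot> tgt g) = W (src f) g \<I> \<cdot> W \<I> f (tgt g)"
    using assms by (simp add: W_def comp_def ids units)
qed

lemma interchange:
  assumes "arr f" "arr g" "X \<in> obj C" "Y \<in> obj C" "Z \<in> obj C"
  shows "W X f (Y \<odot> src g \<odot> Z) \<cdot> W (X \<odot> tgt f \<odot> Y) g Z
    = W (X \<odot> src f \<odot> Y) g Z \<cdot> W X f (Y \<odot> tgt g \<odot> Z)"
proof -
  have "W \<I> f (Y \<odot> src g) \<cdot> W (tgt f \<odot> Y) g \<I> = W (src f \<odot> Y) g \<I> \<cdot> W \<I> f (Y \<odot> tgt g)"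
    using assms tensor_W[of f "W Y g \<I>"] by simp
  from arg_cong[OF this, of "\<lambda>h. W X h Z"] show ?thesis
    using assms by simp
qed

text \<open>In right-nested normal form two adjacent factors usually have a tail \<open>k\<close>
  behind them, so an equation between short composites does not match. This rule and the other ones
  ending in \<open>_post\<close> supply the tail.\<close>

lemma comp_post:
  assumes "f \<cdot> g = h" "arr f" "arr g" "tgt f = src g" "arr k" "tgt g = src k"
  shows "f \<cdot> g \<cdot> k = h \<cdot> k"
  using assms comp_assoc[of f g k] by simp

lemma interchange_post:
  assumes "arr f" "arr g" "X \<in> obj C" "Y \<in> obj C" "Z \<in> obj C"
    "arr k" "src k = X \<odot> tgt f \<odot> Y \<odot> tgt g \<odot> Z"
  shows "W X f (Y \<odot> src g \<odot> Z) \<cdot> W (X \<odot> tgt f \<odot> Y) g Z \<cdot> k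
    = W (X \<odot> src f \<odot> Y) g Z \<cdot> W X f (Y \<odot> tgt g \<odot> Z) \<cdot> k"
  using comp_post[OF interchange[of f g X Y Z], of k] assms by simp

lemma mor_idt: "mor (idt X) = \<one> X"
  by (simp add: idt_def)

lemma W_left: "\<lbrakk>arr f; X \<in> obj C\<rbrakk> \<Longrightarrow> W \<I> f X = (src f \<odot> X, mor f \<otimes> \<one> X, tgt f \<odot> X)"
  using tensor_W(1)[of f "idt X"] by (simp add: mor_idt)

lemma W_right: "\<lbrakk>arr f; X \<in> obj C\<rbrakk> \<Longrightarrow> W X f \<I> = (X \<odot> src f, \<one> X \<otimes> mor f, X \<odot> tgt f)"
  using tensor_W(1)[of "idt X" f] by (simp add: mor_idt)

lemma iso_triple:
  assumes "X \<in> obj C" "Y \<in> obj C" "is_iso C X Y f"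
  shows "arr (X, f, Y)" "arr (Y, inv_arr C X Y f, X)"
    "(X, f, Y) \<cdot> (Y, inv_arr C X Y f, X) = idt X"
    "(Y, inv_arr C X Y f, X) \<cdot> (X, f, Y) = idt Y"
  using inv_arr_inverse[OF assms] assms(1,2)
  by (auto simp: inverse_arrows_def arr_triple comp_def idt_def)

lemma W_cancel:
  assumes "f \<cdot> g = idt (src f)" "arr f" "arr g" "tgt f = src g" "X \<in> obj C" "Y \<in> obj C"
  shows "W X f Y \<cdot> W X g Y = idt (X \<odot> src f \<odot> Y)"
  using arg_cong[OF assms(1), of "\<lambda>h. W X h Y"] assms(2-) by simp

lemma W_cancel_post:
  assumes "f \<cdot> g = idt (src f)" "arr f" "arr g" "tgt f = src g" "X \<in> obj C" "Y \<in> obj C"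
    "arr k" "src k = X \<odot> src f \<odot> Y"
  shows "W X f Y \<cdot> W X g Y \<cdot> k = k"
proof -
  have "tgt g = src f"
    using arg_cong[OF assms(1), of tgt] by simp
  then show ?thesis
    using comp_post[OF W_cancel[of f g X Y], of k] assms by simp
qed

end

section \<open>Braids, twists and rotation\<close>

context strict_braided_category
begin

definition br :: "'o \<Rightarrow> 'o \<Rightarrow> 'o \<times> 'm \<times> 'o" where
  "br X Y = (X \<odot> Y, \<sigma> X Y, Y \<odot> X)"

definition bri :: "'o \<Rightarrow> 'o \<Rightarrow> 'o \<times> 'm \<times> 'o" where
  "bri X Y = (Y \<odot> X, inv_arr C (X \<odot> Y) (Y \<odot> X) (\<sigma> X Y), X \<odot> Y)"

lemma src_br [simp]: "src (br X Y) = X \<odot> Y"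
  and tgt_br [simp]: "tgt (br X Y) = Y \<odot> X"
  and src_bri [simp]: "src (bri X Y) = Y \<odot> X"
  and tgt_bri [simp]: "tgt (bri X Y) = X \<odot> Y"
  by (simp_all add: br_def bri_def)

lemma br_bri [simp]:
  assumes "X \<in> obj C" "Y \<in> obj C"
  shows "arr (br X Y)" "arr (bri X Y)" "br X Y \<cdot> bri X Y = idt (X \<odot> Y)"
    "bri X Y \<cdot> br X Y = idt (Y \<odot> X)"
  using assms iso_triple[OF _ _ braid_iso[OF assms]] by (simp_all add: br_def bri_def)

lemma br_natural_left:
  assumes "arr f" "Y \<in> obj C"
  shows "W \<I> f Y \<cdot> br (tgt f) Y = br (src f) Y \<cdot> W Y f \<I>"
  using assms braid_natural[of "src f" "tgt f" Y Y "mor f" "\<one> Y"]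
  by (simp add: W_left W_right br_def comp_def ident_hom arr_mor)

lemma br_natural_right:
  assumes "arr f" "X \<in> obj C"
  shows "W X f \<I> \<cdot> br X (tgt f) = br X (src f) \<cdot> W \<I> f X"
  using assms braid_natural[of X X "src f" "tgt f" "\<one> X" "mor f"]
  by (simp add: W_left W_right br_def comp_def ident_hom arr_mor)

lemma br_tensor_right:
  assumes "X \<in> obj C" "Y \<in> obj C" "Z \<in> obj C"
  shows "br X (Y \<odot> Z) = W \<I> (br X Y) Z \<cdot> W Y (br X Z) \<I>"
  using assms hexagon1[OF assms] by (subst W_left W_right, simp, simp)+ (simp add: br_def comp_def)

lemma br_tensor_left:
  assumes "X \<in> obj C" "Y \<in> obj C" "Z \<in> obj C"
  shows "br (X \<odot> Y) Z = W X (br Y Z) \<I> \<cdot> W \<I> (br X Z) Y"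
  using assms hexagon2[OF assms] by (subst W_left W_right, simp, simp)+ (simp add: br_def comp_def)

text \<open>An idempotent with a right inverse is an identity. The hexagons and
  \<open>tw_tensor\<close> at \<I> only say that the braids and the twist of \<I> are idempotent;
  invertibility does the rest.\<close>

lemma idempotent_iso:
  assumes "f = f \<cdot> f" "arr f" "arr g" "f \<cdot> g = idt (src f)" "tgt f = src f" "src g = src f"
  shows "f = idt (src f)"
  using assms comp_assoc[of f f g] by simp

lemma br_unit_left [simp]: "X \<in> obj C \<Longrightarrow> br \<I> X = idt X"
  using idempotent_iso[of "br \<I> X" "bri \<I> X"] br_tensor_left[of \<I> \<I> X] by simp

lemma br_unit_right [simp]: "X \<in> obj C \<Longrightarrow> br X \<I> = idt X"
  using idempotent_iso[of "br X \<I>" "bri X \<I>"] br_tensor_right[of X \<I> \<I>] by simp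

end

section \<open>Twists, duals and the trace as bundled arrows\<close>

context ribbon_category
begin

declare dual_obj [simp]

definition tw :: "'o \<Rightarrow> 'o \<times> 'm \<times> 'o" where "tw X = (X, \<theta> X, X)"
definition twi :: "'o \<Rightarrow> 'o \<times> 'm \<times> 'o" where "twi X = (X, inv_arr C X X (\<theta> X), X)"
definition cv :: "'o \<Rightarrow> 'o \<times> 'm \<times> 'o" where "cv X = (\<I>, \<eta> X, X \<odot> X\<^sup>\<star>)"
definition cn :: "'o \<Rightarrow> 'o \<times> 'm \<times> 'o" where "cn X = (X\<^sup>\<star> \<odot> X, \<epsilon> X, \<I>)"

lemma src_tgt_ribbon [simp]:
  "src (tw X) = X" "tgt (tw X) = X" "src (twi X) = X" "tgt (twi X) = X"
  "src (cv X) = \<I>" "tgt (cv X) = X \<odot> X\<^sup>\<star>" "src (cn X) = X\<^sup>\<star> \<odot> X" "tgt (cn X) = \<I>"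
  by (simp_all add: tw_def twi_def cv_def cn_def)

lemma tw_twi [simp]:
  assumes "X \<in> obj C"
  shows "arr (tw X)" "arr (twi X)" "tw X \<cdot> twi X = idt X" "twi X \<cdot> tw X = idt X"
  using iso_triple[OF assms assms twist_iso[OF assms]] by (simp_all add: tw_def twi_def)

lemma arr_cv [simp]: "X \<in> obj C \<Longrightarrow> arr (cv X)"
  by (simp add: arr_triple cv_def coev_hom)

lemma arr_cn [simp]: "X \<in> obj C \<Longrightarrow> arr (cn X)"
  by (simp add: arr_triple cn_def ev_hom)

lemma tw_natural: "arr f \<Longrightarrow> f \<cdot> tw (tgt f) = tw (src f) \<cdot> f"
  using twist_natural[of "src f" "tgt f" "mor f"] by (simp add: arr_mor tw_def comp_def)

lemma tw_tensor:
  assumes "X \<in> obj C" "Y \<in> obj C"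
  shows "tw (X \<odot> Y) = br X Y \<cdot> W \<I> (tw Y) X \<cdot> W Y (tw X) \<I> \<cdot> br Y X"
proof -
  have "W \<I> (tw Y) X \<cdot> W Y (tw X) \<I> = (Y \<odot> X, \<theta> Y \<otimes> \<theta> X, Y \<odot> X)"
    using assms tensor_W(1)[of "tw Y" "tw X"] by (simp add: mor_def) (simp add: tw_def)
  then have "(br X Y \<cdot> (W \<I> (tw Y) X \<cdot> W Y (tw X) \<I>)) \<cdot> br Y X = tw (X \<odot> Y)"
    using twist_tensor[OF assms] by (simp add: br_def tw_def comp_def)
  then show ?thesis using assms by simp
qed

lemma tw_unit [simp]: "tw \<I> = idt \<I>"
  using idempotent_iso[of "tw \<I>" "twi \<I>"] tw_tensor[of \<I> \<I>] by simp

lemma snake_left: "X \<in> obj C \<Longrightarrow> W \<I> (cv X) X \<cdot> W X (cn X) \<I> = idt X"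
  using snake1[of X] by (simp add: W_left W_right) (simp add: cv_def cn_def comp_def idt_def)

lemma snake_right: "X \<in> obj C \<Longrightarrow> W (X\<^sup>\<star>) (cv X) \<I> \<cdot> W \<I> (cn X) (X\<^sup>\<star>) = idt (X\<^sup>\<star>)"
  using snake2[of X] by (simp add: W_left W_right) (simp add: cv_def cn_def comp_def idt_def)

lemma tw_dual:
  assumes "X \<in> obj C"
  shows "W (X\<^sup>\<star>) (cv X) \<I> \<cdot> W (X\<^sup>\<star>) (tw X) (X\<^sup>\<star>) \<cdot> W \<I> (cn X) (X\<^sup>\<star>) = tw (X\<^sup>\<star>)"
proof -
  have "(W (X\<^sup>\<star>) (cv X) \<I> \<cdot> W (X\<^sup>\<star>) (tw X) (X\<^sup>\<star>)) \<cdot> W \<I> (cn X) (X\<^sup>\<star>) = tw (X\<^sup>\<star>)"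
    using assms twist_dual[OF assms] unfolding dual_arr_def
    by (simp add: W_left W_right del: comp_assoc) (simp add: W_def cv_def cn_def tw_def comp_def)
  then show ?thesis using assms by simp
qed

lemma trace_triple:
  assumes "arr f" "src f = U \<odot> X" "tgt f = V \<odot> X" "X \<in> obj C" "U \<in> obj C" "V \<in> obj C"
  shows "(U, trace U V X (mor f), V) = W U (cv X) \<I> \<cdot> W \<I> f (X\<^sup>\<star>) \<cdot>
    W V (br X (X\<^sup>\<star>) \<cdot> W (X\<^sup>\<star>) (tw X) \<I> \<cdot> cn X) \<I>"
proof -
  define e where "e = br X (X\<^sup>\<star>) \<cdot> W (X\<^sup>\<star>) (tw X) \<I> \<cdot> cn X"
  have [simp]: "arr e" "src e = X \<odot> X\<^sup>\<star>" "tgt e = \<I>"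
    using assms by (simp_all add: e_def)
  have "e = (br X (X\<^sup>\<star>) \<cdot> W (X\<^sup>\<star>) (tw X) \<I>) \<cdot> cn X"
    using assms by (simp add: e_def)
  then have e: "mor e = \<sigma> X (X\<^sup>\<star>) ;; (\<one> (X\<^sup>\<star>) \<otimes> \<theta> X) ;; \<epsilon> X"
    using assms by (simp add: W_right del: comp_assoc) (simp add: br_def tw_def cn_def comp_def)
  have "(W U (cv X) \<I> \<cdot> W \<I> f (X\<^sup>\<star>)) \<cdot> W V e \<I> = (U, trace U V X (mor f), V)"
    unfolding trace_def e[symmetric] using assms
    by (simp add: W_left W_right del: comp_assoc) (simp add: comp_def cv_def)
  then show ?thesis using assms by (simp del: W_comp flip: e_def)
qed

text \<open>
  \<open>R P Q u\<close> drags the strand \<open>P\<close> of \<open>u\<close> past \<open>Q\<close> to the far right, adding a full twist. It is the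
  bijection relating the unit \<open>cv' X : \<I> \<rightarrow> X\<^sup>\<star> \<odot> X\<close> for \<open>X\<^sup>\<star>\<close> as a right dual to the given unit
  \<open>cv X : \<I> \<rightarrow> X \<odot> X\<^sup>\<star>\<close>.
\<close>

definition R :: "'o \<Rightarrow> 'o \<Rightarrow> 'o \<times> 'm \<times> 'o \<Rightarrow> 'o \<times> 'm \<times> 'o" where
  "R P Q u = u \<cdot> br P Q \<cdot> W Q (tw P) \<I>"

lemma R_inject:
  assumes "arr u" "arr v" "tgt u = P \<odot> Q" "tgt v = P \<odot> Q" "P \<in> obj C" "Q \<in> obj C"
    and "R P Q u = R P Q v"
  shows "u = v"
proof -
  have "R P Q w \<cdot> W Q (twi P) \<I> \<cdot> bri P Q = w" if "arr w" "tgt w = P \<odot> Q" for w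
    using that assms(5,6) by (simp add: R_def W_cancel_post)
  then show ?thesis
    using assms by metis
qed

lemma R_natural_left:
  assumes "arr u" "arr f" "tgt u = src f \<odot> Q" "Q \<in> obj C"
  shows "R (tgt f) Q (u \<cdot> W \<I> f Q) = R (src f) Q u \<cdot> W Q f \<I>"
proof -
  have "W Q f \<I> \<cdot> W Q (tw (tgt f)) \<I> = W Q (tw (src f)) \<I> \<cdot> W Q f \<I>"
    using arg_cong[OF tw_natural[of f], of "\<lambda>h. W Q h \<I>"] assms by simp
  then show ?thesis
    using assms by (simp add: R_def comp_post[OF br_natural_left])
qed

lemma R_natural_right:
  assumes "arr u" "arr g" "tgt u = P \<odot> src g" "P \<in> obj C"
  shows "R P (tgt g) (u \<cdot> W P g \<I>) = R P (src g) u \<cdot> W \<I> g P"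
  using assms interchange[of g "tw P" \<I> \<I> \<I>]
  by (simp add: R_def comp_post[OF br_natural_right])

text \<open>Rotating \<open>P\<close> and then \<open>P'\<close> makes these two strands cross each
  other twice. This full crossing is what \<open>tw_tensor\<close> contains beyond the two separate
  twists, so the twist in \<open>R\<close> is what makes rotation compatible with tensor
  products.\<close>

lemma R_tensor:
  assumes "arr u" "tgt u = P \<odot> P' \<odot> Q" "P \<in> obj C" "P' \<in> obj C" "Q \<in> obj C"
  shows "R P' (Q \<odot> P) (R P (P' \<odot> Q) u) = R (P \<odot> P') Q u"
proof -
  have "br (P \<odot> P') Q \<cdot> W Q (tw (P \<odot> P')) \<I>
    = br (P \<odot> P') Q \<cdot> W Q (br P P') \<I> \<cdot> W Q (tw P') P \<cdot> W (Q \<odot> P') (tw P) \<I> \<cdot> W Q (br P' P) \<I>"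
    using assms by (simp add: tw_tensor)
  also have "\<dots> = W \<I> (br P P') Q \<cdot> br (P' \<odot> P) Q \<cdot>
      W Q (tw P') P \<cdot> W (Q \<odot> P') (tw P) \<I> \<cdot> W Q (br P' P) \<I>"
    using assms comp_post[OF br_natural_left[of "br P P'" Q]] by simp
  also have "\<dots> = W \<I> (br P P') Q \<cdot> W P' (br P Q) \<I> \<cdot> W \<I> (br P' Q) P \<cdot>
      W Q (tw P') P \<cdot> W (Q \<odot> P') (tw P) \<I> \<cdot> W Q (br P' P) \<I>"
    using assms by (simp add: br_tensor_left)
  also have "\<dots> = W \<I> (br P P') Q \<cdot> W P' (br P Q) \<I> \<cdot> W \<I> (br P' Q) P \<cdot>
      W (Q \<odot> P') (tw P) \<I> \<cdot> W Q (tw P') P \<cdot> W Q (br P' P) \<I>"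
    using assms interchange_post[of "tw P'" "tw P" Q \<I> \<I> "W Q (br P' P) \<I>"] by simp
  also have "W Q (tw P') P \<cdot> W Q (br P' P) \<I> = W Q (br P' P) \<I> \<cdot> W (Q \<odot> P) (tw P') \<I>"
    using assms arg_cong[OF br_natural_left[of "tw P'" P], of "\<lambda>h. W Q h \<I>"] by simp
  also have "W \<I> (br P' Q) P \<cdot> W (Q \<odot> P') (tw P) \<I> \<cdot> W Q (br P' P) \<I> \<cdot> W (Q \<odot> P) (tw P') \<I>
    = W (P' \<odot> Q) (tw P) \<I> \<cdot> W \<I> (br P' Q) P \<cdot> W Q (br P' P) \<I> \<cdot> W (Q \<odot> P) (tw P') \<I>"
    using assms interchange_post[of "br P' Q" "tw P" \<I> \<I> \<I>
        "W Q (br P' P) \<I> \<cdot> W (Q \<odot> P) (tw P') \<I>"] by simp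
  finally show ?thesis
    using assms by (simp add: R_def br_tensor_right)
qed

section \<open>The dual object as a right dual\<close>

definition cv' :: "'o \<Rightarrow> 'o \<times> 'm \<times> 'o" where
  "cv' X = cv X \<cdot> W X (twi (X\<^sup>\<star>)) \<I> \<cdot> bri (X\<^sup>\<star>) X"

text \<open>The cap that closes the strand in \<open>trace\<close>; it is the counit that goes with
  \<open>cv'\<close>.\<close>

definition cn' :: "'o \<Rightarrow> 'o \<times> 'm \<times> 'o" where
  "cn' X = br X (X\<^sup>\<star>) \<cdot> W (X\<^sup>\<star>) (tw X) \<I> \<cdot> cn X"

lemma src_tgt_cv'_cn' [simp]:
  "src (cv' X) = \<I>" "X \<in> obj C \<Longrightarrow> tgt (cv' X) = X\<^sup>\<star> \<odot> X"
  "X \<in> obj C \<Longrightarrow> src (cn' X) = X \<odot> X\<^sup>\<star>" "tgt (cn' X) = \<I>"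
  by (simp_all add: cv'_def cn'_def)

lemma arr_cv'_cn' [simp]:
  assumes "X \<in> obj C"
  shows "arr (cv' X)" "arr (cn' X)"
  using assms by (simp_all add: cv'_def cn'_def)

lemma R_cv': "X \<in> obj C \<Longrightarrow> R (X\<^sup>\<star>) X (cv' X) = cv X"
  using W_cancel[of "twi (X\<^sup>\<star>)" "tw (X\<^sup>\<star>)" X \<I>]
    comp_post[OF br_bri(4), of "X\<^sup>\<star>" X "W X (tw (X\<^sup>\<star>)) \<I>"]
  by (simp add: R_def cv'_def)

text \<open>Naturality removes the braids, leaving the snake of the given cup and cap with
  \<open>tw X\<close> on one strand and \<open>twi D\<close> on another. Since \<open>tw X\<close>
  transposes to \<open>tw D\<close> by \<open>tw_dual\<close>, the twists cancel.\<close>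

lemma snake_right':
  assumes X: "X \<in> obj C"
  shows "W \<I> (cv' X) (X\<^sup>\<star>) \<cdot> W (X\<^sup>\<star>) (cn' X) \<I> = idt (X\<^sup>\<star>)"
proof -
  define D where "D = X\<^sup>\<star>"
  define e where "e = W D (tw X) \<I> \<cdot> cn X"
  define c where "c = cv X \<cdot> W X (twi D) \<I>"
  have D [simp]: "D \<in> obj C" using X by (simp add: D_def)
  have e [simp]: "arr e" "src e = D \<odot> X" "tgt e = \<I>"
    using X by (simp_all add: e_def D_def)
  have c [simp]: "arr c" "src c = \<I>" "tgt c = X \<odot> D"
    using X by (simp_all add: c_def D_def)
  have cv': "cv' X = c \<cdot> bri D X" and cn': "cn' X = br X D \<cdot> e"
    using X by (simp_all add: cv'_def cn'_def c_def e_def D_def)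
  \<comment> \<open>Dragging the free strand \<open>D\<close> across the whole cup costs nothing, as
    braiding with \<I> is trivial. Its crossing with the strand \<open>D\<close> of the cup is moved
    to the other side, where it appears inverted.\<close>
  have *: "W \<I> c D \<cdot> W \<I> (bri D X) D \<cdot> W D (br X D) \<I>
    = W D c \<I> \<cdot> W D (bri D X) \<I> \<cdot> W \<I> (bri D D) X"
  proof -
    have "W \<I> (c \<cdot> bri D X) D \<cdot> br (D \<odot> X) D = W D (c \<cdot> bri D X) \<I>"
      using X br_natural_left[of "c \<cdot> bri D X" D] by simp
    then have "W \<I> c D \<cdot> W \<I> (bri D X) D \<cdot> W D (br X D) \<I> \<cdot> W \<I> (br D D) X
      = W D c \<I> \<cdot> W D (bri D X) \<I>"
      using X by (simp add: br_tensor_left)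
    then have "(W \<I> c D \<cdot> W \<I> (bri D X) D \<cdot> W D (br X D) \<I> \<cdot> W \<I> (br D D) X) \<cdot> W \<I> (bri D D) X
      = (W D c \<I> \<cdot> W D (bri D X) \<I>) \<cdot> W \<I> (bri D D) X"
      by simp
    then show ?thesis using X W_cancel[of "br D D" "bri D D" \<I> X] by simp
  qed
  \<comment> \<open>The same for the cap; the inverse crossings left by the previous identity are
    absorbed here.\<close>
  have **: "W D (bri D X) \<I> \<cdot> W \<I> (bri D D) X \<cdot> W D e \<I> = W \<I> e D"
  proof -
    have "W D e \<I> = W \<I> (br D D) X \<cdot> W D (br D X) \<I> \<cdot> W \<I> e D"
      using X br_natural_right[of e D] by (simp add: br_tensor_right)
    then show ?thesis
      using X by (simp add: W_cancel_post)
  qed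
  have "W \<I> (cv' X) D \<cdot> W D (cn' X) \<I>
    = (W \<I> c D \<cdot> W \<I> (bri D X) D \<cdot> W D (br X D) \<I>) \<cdot> W D e \<I>"
    using X by (simp add: cv' cn')
  also have "\<dots> = W D c \<I> \<cdot> W \<I> e D"
    unfolding * using X by (simp add: **)
  also have "\<dots> = W D (cv X) \<I> \<cdot> W (D \<odot> X) (twi D) \<I> \<cdot> W D (tw X) D \<cdot> W \<I> (cn X) D"
    using X by (simp add: c_def e_def D_def)
  also have "\<dots> = W D (cv X) \<I> \<cdot> W D (tw X) D \<cdot> W (D \<odot> X) (twi D) \<I> \<cdot> W \<I> (cn X) D"
    using X interchange_post[of "tw X" "twi D" D \<I> \<I> "W \<I> (cn X) D"] by (simp add: D_def)
  also have "\<dots> = W D (cv X) \<I> \<cdot> W D (tw X) D \<cdot> W \<I> (cn X) D \<cdot> twi D"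
    using X interchange[of "cn X" "twi D" \<I> \<I> \<I>] by (simp add: D_def)
  also have "\<dots> = (W D (cv X) \<I> \<cdot> W D (tw X) D \<cdot> W \<I> (cn X) D) \<cdot> twi D"
    using X by (simp add: D_def)
  also have "\<dots> = idt D"
    using X tw_dual[OF X] by (simp flip: D_def)
  finally show ?thesis by (simp add: D_def)
qed

end

section \<open>Currying with respect to a reflexive object\<close>

context reflexive_object
begin

declare A_obj [simp]

abbreviation D :: 'o where "D \<equiv> A\<^sup>\<star>"

lemma tpow_obj [simp]: "tpow A k \<in> obj C"
  by (induction k) simp_all

text \<open>
  The nested dual of \<open>A\<^sup>\<otimes>\<^sup>k\<close> replaces the chosen dual of that object, so that \<open>lams\<close> and \<open>apps\<close>
  unfold along the same recursion as its unit and counit.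
\<close>

primrec dpow :: "nat \<Rightarrow> 'o" where
  "dpow 0 = \<I>"
| "dpow (Suc k) = dpow k \<odot> D"

lemma dpow_obj [simp]: "dpow k \<in> obj C"
  by (induction k) simp_all

section \<open>Nested cups and caps, and folding of strands by \<phi>\<close>

definition ph :: "'o \<times> 'm \<times> 'o" where "ph = (A \<odot> D, \<phi>, A)"
definition ps :: "'o \<times> 'm \<times> 'o" where "ps = (A, inv_arr C (A \<odot> D) A \<phi>, A \<odot> D)"
definition ap :: "'o \<times> 'm \<times> 'o" where "ap = W \<I> ps A \<cdot> W A (cn A) \<I>"
text \<open>The inverse twist and inverse braid in \<open>lam\<close> are those of
  \<open>cv'\<close>, so abstraction is a right-dual cup followed by \<phi>.\<close>

definition lm :: "'o \<times> 'm \<times> 'o" where "lm = W A (cv' A) \<I> \<cdot> W \<I> ph A"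

lemma ph_ps [simp]:
  "src ph = A \<odot> D" "tgt ph = A" "src ps = A" "tgt ps = A \<odot> D"
  "arr ph" "arr ps" "ph \<cdot> ps = idt (A \<odot> D)" "ps \<cdot> ph = idt A"
  using iso_triple[OF _ _ phi_iso] by (simp_all add: ph_def ps_def)

lemma ap_lm [simp]:
  "src ap = A \<odot> A" "tgt ap = A" "arr ap" "src lm = A" "tgt lm = A \<odot> A" "arr lm"
  by (simp_all add: ap_def lm_def)

primrec aps :: "nat \<Rightarrow> 'o \<times> 'm \<times> 'o" where
  "aps 0 = idt A"
| "aps (Suc k) = W \<I> ap (tpow A k) \<cdot> aps k"

primrec lms :: "nat \<Rightarrow> 'o \<times> 'm \<times> 'o" where
  "lms 0 = idt A"
| "lms (Suc k) = lms k \<cdot> W \<I> lm (tpow A k)"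

primrec cvs :: "nat \<Rightarrow> 'o \<times> 'm \<times> 'o" where
  "cvs 0 = idt \<I>"
| "cvs (Suc k) = cv A \<cdot> W A (cvs k) D"

primrec cns :: "nat \<Rightarrow> 'o \<times> 'm \<times> 'o" where
  "cns 0 = idt \<I>"
| "cns (Suc k) = W (dpow k) (cn A) (tpow A k) \<cdot> cns k"

primrec cvs' :: "nat \<Rightarrow> 'o \<times> 'm \<times> 'o" where
  "cvs' 0 = idt \<I>"
| "cvs' (Suc k) = cvs' k \<cdot> W (dpow k) (cv' A) (tpow A k)"

primrec phs :: "nat \<Rightarrow> 'o \<times> 'm \<times> 'o" where
  "phs 0 = idt A"
| "phs (Suc k) = W \<I> (phs k) D \<cdot> ph"

primrec pss :: "nat \<Rightarrow> 'o \<times> 'm \<times> 'o" where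
  "pss 0 = idt A"
| "pss (Suc k) = ps \<cdot> W \<I> (pss k) D"

lemma arr_aps [simp]: "arr (aps k) \<and> src (aps k) = A \<odot> tpow A k \<and> tgt (aps k) = A"
  by (induction k) simp_all

lemma arr_lms [simp]: "arr (lms k) \<and> src (lms k) = A \<and> tgt (lms k) = A \<odot> tpow A k"
  by (induction k) simp_all

lemma arr_cvs [simp]: "arr (cvs k) \<and> src (cvs k) = \<I> \<and> tgt (cvs k) = tpow A k \<odot> dpow k"
  by (induction k) simp_all

lemma arr_cns [simp]: "arr (cns k) \<and> src (cns k) = dpow k \<odot> tpow A k \<and> tgt (cns k) = \<I>"
  by (induction k) simp_all

lemma arr_cvs' [simp]: "arr (cvs' k) \<and> src (cvs' k) = \<I> \<and> tgt (cvs' k) = dpow k \<odot> tpow A k"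
  by (induction k) simp_all

lemma arr_phs [simp]: "arr (phs k) \<and> src (phs k) = A \<odot> dpow k \<and> tgt (phs k) = A"
  by (induction k) simp_all

lemma arr_pss [simp]: "arr (pss k) \<and> src (pss k) = A \<and> tgt (pss k) = A \<odot> dpow k"
  by (induction k) simp_all

text \<open>Interchange moves the cap of the new strand past the cups of the other \<open>k\<close>
  strands. This separates its snake from theirs, which the induction hypothesis straightens.\<close>

lemma snakes_left: "W \<I> (cvs k) (tpow A k) \<cdot> W (tpow A k) (cns k) \<I> = idt (tpow A k)"
proof (induction k)
  case (Suc k)
  let ?P = "tpow A k" let ?Q = "dpow k"
  have "W \<I> (cvs (Suc k)) (tpow A (Suc k)) \<cdot> W (tpow A (Suc k)) (cns (Suc k)) \<I>
    = W \<I> (cv A) (A \<odot> ?P) \<cdot> W A (cvs k) (D \<odot> A \<odot> ?P) \<cdot> W (A \<odot> ?P \<odot> ?Q) (cn A) ?P \<cdot> W (A \<odot> ?P) (cns k) \<I>"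
    by simp
  also have "\<dots> = W \<I> (cv A) (A \<odot> ?P) \<cdot> W A (cn A) ?P \<cdot> W A (cvs k) ?P \<cdot> W (A \<odot> ?P) (cns k) \<I>"
    using interchange_post[of "cvs k" "cn A" A \<I> ?P "W (A \<odot> ?P) (cns k) \<I>"] by simp
  also have "W A (cvs k) ?P \<cdot> W (A \<odot> ?P) (cns k) \<I> = idt (A \<odot> ?P)"
    using arg_cong[OF Suc, of "\<lambda>h. W A h \<I>"] by simp
  finally show ?case
    using arg_cong[OF snake_left[of A], of "\<lambda>h. W \<I> h ?P"] by simp
qed simp

lemma snakes_right: "W (dpow k) (cvs k) \<I> \<cdot> W \<I> (cns k) (dpow k) = idt (dpow k)"
proof (induction k)
  case (Suc k)
  let ?P = "tpow A k" let ?Q = "dpow k"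
  have "W (dpow (Suc k)) (cvs (Suc k)) \<I> \<cdot> W \<I> (cns (Suc k)) (dpow (Suc k))
    = W (?Q \<odot> D) (cv A) \<I> \<cdot> W (?Q \<odot> D \<odot> A) (cvs k) D \<cdot> W ?Q (cn A) (?P \<odot> ?Q \<odot> D) \<cdot> W \<I> (cns k) (?Q \<odot> D)"
    by simp
  also have "\<dots> = W (?Q \<odot> D) (cv A) \<I> \<cdot> W ?Q (cn A) D \<cdot> W ?Q (cvs k) D \<cdot> W \<I> (cns k) (?Q \<odot> D)"
    using interchange_post[of "cn A" "cvs k" ?Q \<I> D "W \<I> (cns k) (?Q \<odot> D)"] by simp
  also have "W ?Q (cvs k) D \<cdot> W \<I> (cns k) (?Q \<odot> D) = idt (?Q \<odot> D)"
    using arg_cong[OF Suc, of "\<lambda>h. W \<I> h D"] by simp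
  finally show ?case
    using arg_cong[OF snake_right[of A], of "\<lambda>h. W ?Q h \<I>"] by simp
qed simp

text \<open>By \<open>R_tensor\<close> the nest rotates in two moves. Turning \<open>dpow k\<close>
  uses the induction hypothesis and sets the innermost cup \<open>cv' A\<close> free; turning the
  remaining \<open>D\<close> makes it \<open>cv A\<close>, now the outermost cup.\<close>

lemma R_cvs': "R (dpow k) (tpow A k) (cvs' k) = cvs k"
proof (induction k)
  case (Suc k)
  let ?P = "tpow A k" let ?Q = "dpow k"
  have "R (dpow (Suc k)) (tpow A (Suc k)) (cvs' (Suc k))
    = R D (A \<odot> ?P \<odot> ?Q) (R ?Q (D \<odot> A \<odot> ?P) (cvs' k \<cdot> W ?Q (W \<I> (cv' A) ?P) \<I>))"
    using R_tensor[of "cvs' (Suc k)" ?Q D "A \<odot> ?P"] by simp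
  also have "R ?Q (D \<odot> A \<odot> ?P) (cvs' k \<cdot> W ?Q (W \<I> (cv' A) ?P) \<I>) = cvs k \<cdot> W \<I> (cv' A) (?P \<odot> ?Q)"
    using R_natural_right[of "cvs' k" "W \<I> (cv' A) ?P" ?Q] Suc by simp
  also have "\<dots> = cv' A \<cdot> W D (W A (cvs k) \<I>) \<I>"
    using interchange[of "cv' A" "cvs k" \<I> \<I> \<I>] by simp
  also have "R D (A \<odot> ?P \<odot> ?Q) \<dots> = cv A \<cdot> W A (cvs k) D"
    using R_natural_right[of "cv' A" "W A (cvs k) \<I>" D] by (simp add: R_cv')
  finally show ?case by simp
qed (simp add: R_def)

lemma phs_pss [simp]: "phs k \<cdot> pss k = idt (A \<odot> dpow k)"
proof (induction k)
  case (Suc k)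
  then show ?case
    using comp_post[OF ph_ps(7)] W_cancel[of "phs k" "pss k" \<I> D] by simp
qed simp

lemma pss_phs [simp]: "pss k \<cdot> phs k = idt A"
proof (induction k)
  case (Suc k)
  then show ?case
    using W_cancel_post[of "pss k" "phs k" \<I> D ph] by simp
qed simp

text \<open>Each \<phi> cancels the inverse hidden in the matching \<open>ap\<close>, so that only
  evaluations remain.\<close>

lemma phs_aps: "W \<I> (phs k) (tpow A k) \<cdot> aps k = W A (cns k) \<I>"
proof (induction k)
  case (Suc k)
  let ?P = "tpow A k" let ?Q = "dpow k"
  have "W \<I> (phs (Suc k)) (tpow A (Suc k)) \<cdot> aps (Suc k) = W \<I> (phs k) (D \<odot> A \<odot> ?P) \<cdot> W A (cn A) ?P \<cdot> aps k"
    by (simp add: ap_def W_cancel_post)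
  also have "\<dots> = W (A \<odot> ?Q) (cn A) ?P \<cdot> W \<I> (phs k) ?P \<cdot> aps k"
    using interchange_post[of "phs k" "cn A" \<I> \<I> ?P "aps k"] by simp
  finally show ?case using Suc by simp
qed simp

text \<open>Separates the creation of the strands from their absorption into \<open>A\<close> by
  \<phi>, so that \<open>tr_lms\<close> can work on the cups alone.\<close>

lemma lms_eq: "lms k = W A (cvs' k) \<I> \<cdot> W \<I> (phs k) (tpow A k)"
proof (induction k)
  case (Suc k)
  let ?P = "tpow A k" let ?Q = "dpow k"
  have "lms (Suc k) = W A (cvs' k) \<I> \<cdot> W \<I> (phs k) ?P \<cdot> W A (cv' A) ?P \<cdot> W \<I> ph (A \<odot> ?P)"
    using Suc by (simp add: lm_def)
  also have "\<dots> = W A (cvs' k) \<I> \<cdot> W (A \<odot> ?Q) (cv' A) ?P \<cdot> W \<I> (phs k) (D \<odot> A \<odot> ?P) \<cdot> W \<I> ph (A \<odot> ?P)"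
    using interchange_post[of "phs k" "cv' A" \<I> \<I> ?P "W \<I> ph (A \<odot> ?P)"] by simp
  finally show ?case by simp
qed simp

section \<open>The trace of an iterated abstraction\<close>

definition tr :: "'o \<times> 'm \<times> 'o \<Rightarrow> 'o \<times> 'm \<times> 'o" where
  "tr f = cv A \<cdot> W \<I> f D \<cdot> W A (cn' A) \<I>"

text \<open>
  Sliding \<open>g\<close> through the unit \<open>cvs'\<close> turns it into its transpose \<open>gs\<close>. Both sides of this
  identity agree after rotation, where it becomes a planar one.
\<close>

lemma tr_lms:
  assumes g: "arr g" "src g = tpow A k" "tgt g = A"
  shows "tr (lms k \<cdot> W A g \<I>) = cvs k \<cdot> W \<I> g (dpow k) \<cdot> phs k"
proof -
  let ?P = "tpow A k" let ?Q = "dpow k"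
  define h where "h = cvs k \<cdot> W \<I> g ?Q"
  have h [simp]: "arr h" "src h = \<I>" "tgt h = A \<odot> ?Q"
    using g by (simp_all add: h_def)
  define gs where "gs = W D h \<I> \<cdot> W \<I> (cn A) ?Q"
  have gs [simp]: "arr gs" "src gs = D" "tgt gs = ?Q"
    using g by (simp_all add: gs_def)
  have 1: "cv A \<cdot> W A gs \<I> = h"
  proof -
    have "cv A \<cdot> W A gs \<I> = h \<cdot> W \<I> (cv A) (A \<odot> ?Q) \<cdot> W A (cn A) ?Q"
      using interchange_post[of "cv A" h \<I> \<I> \<I> "W A (cn A) ?Q"] by (simp add: gs_def)
    then show ?thesis
      using arg_cong[OF snake_left[of A], of "\<lambda>f. W \<I> f ?Q"] by simp
  qed
  have 2: "cvs' k \<cdot> W ?Q g \<I> = cv' A \<cdot> W \<I> gs A"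
  proof (rule R_inject)
    show "R ?Q A (cvs' k \<cdot> W ?Q g \<I>) = R ?Q A (cv' A \<cdot> W \<I> gs A)"
      using R_natural_right[of "cvs' k" g ?Q] R_natural_left[of "cv' A" gs A] 1 g
      by (simp add: R_cv' R_cvs' h_def)
  qed (use g in simp_all)
  have "tr (lms k \<cdot> W A g \<I>)
    = cv A \<cdot> W A (cvs' k) D \<cdot> W \<I> (phs k) (?P \<odot> D) \<cdot> W A g D \<cdot> W A (cn' A) \<I>"
    using g by (simp add: tr_def lms_eq)
  also have "\<dots> = cv A \<cdot> W A (cvs' k) D \<cdot> W (A \<odot> ?Q) g D \<cdot> W \<I> (phs k) (A \<odot> D) \<cdot> W A (cn' A) \<I>"
    using g interchange_post[of "phs k" g \<I> \<I> D "W A (cn' A) \<I>"] by simp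
  also have "\<dots> = cv A \<cdot> W A (cvs' k) D \<cdot> W (A \<odot> ?Q) g D \<cdot> W (A \<odot> ?Q) (cn' A) \<I> \<cdot> phs k"
    using interchange[of "phs k" "cn' A" \<I> \<I> \<I>] by simp
  also have "\<dots> = cv A \<cdot> W A (cvs' k \<cdot> W ?Q g \<I>) D \<cdot> W (A \<odot> ?Q) (cn' A) \<I> \<cdot> phs k"
    using g by simp
  also have "\<dots> = cv A \<cdot> W A (cv' A) D \<cdot> W A gs (A \<odot> D) \<cdot> W (A \<odot> ?Q) (cn' A) \<I> \<cdot> phs k"
    unfolding 2 by simp
  also have "\<dots> = cv A \<cdot> W A (cv' A) D \<cdot> W (A \<odot> D) (cn' A) \<I> \<cdot> W A gs \<I> \<cdot> phs k"
    using interchange_post[of gs "cn' A" A \<I> \<I> "phs k"] by simp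
  also have "\<dots> = cv A \<cdot> (W A (cv' A) D \<cdot> W (A \<odot> D) (cn' A) \<I>) \<cdot> W A gs \<I> \<cdot> phs k"
    by simp
  also have "W A (cv' A) D \<cdot> W (A \<odot> D) (cn' A) \<I> = idt (A \<odot> D)"
    using arg_cong[OF snake_right'[of A], of "\<lambda>f. W A f \<I>"] by simp
  also have "cv A \<cdot> idt (A \<odot> D) \<cdot> W A gs \<I> \<cdot> phs k = h \<cdot> phs k"
    using comp_post[OF 1, of "phs k"] by simp
  finally show ?thesis using g by (simp add: h_def)
qed

text \<open>Existence half of currying: \<open>phs_aps\<close> exposes the caps, which meet the cups
  in nested snakes. For \<open>X = \<I>\<close> the curried arrow is the value of the trace in
  \<open>tr_lms\<close>.\<close>

lemma uncurry:
  assumes g: "arr g" "src g = X \<odot> tpow A k" "tgt g = A" "X \<in> obj C"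
  shows "W \<I> (W X (cvs k) \<I> \<cdot> W \<I> g (dpow k) \<cdot> phs k) (tpow A k) \<cdot> aps k = g"
proof -
  let ?P = "tpow A k" let ?Q = "dpow k"
  have "W \<I> (W X (cvs k) \<I> \<cdot> W \<I> g ?Q \<cdot> phs k) ?P \<cdot> aps k
    = W X (cvs k) ?P \<cdot> W \<I> g (?Q \<odot> ?P) \<cdot> W A (cns k) \<I>"
    using g by (simp add: phs_aps)
  also have "\<dots> = W X (cvs k) ?P \<cdot> W (X \<odot> ?P) (cns k) \<I> \<cdot> g"
    using g interchange[of g "cns k" \<I> \<I> \<I>] by simp
  also have "\<dots> = g"
  proof -
    have "W X (cvs k) ?P \<cdot> W (X \<odot> ?P) (cns k) \<I> = idt (X \<odot> ?P)"
      using g arg_cong[OF snakes_left[of k], of "\<lambda>f. W X f \<I>"] by simp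
    then show ?thesis using g comp_post[of _ _ "idt (X \<odot> ?P)" g] by simp
  qed
  finally show ?thesis .
qed

lemma pss_cns: "W \<I> (pss k) (tpow A k) \<cdot> W A (cns k) \<I> = aps k"
  using W_cancel_post[of "pss k" "phs k" \<I> "tpow A k" "aps k"] by (simp add: phs_aps)

text \<open>Uniqueness half of currying: bending the \<open>k\<close> arguments back by
  \<open>cvs k\<close> recovers \<open>h \<cdot> pss k\<close>, and \<open>pss k\<close> is
  invertible.\<close>

lemma aps_extensional:
  assumes f: "arr f" "src f = X" "tgt f = A" and g: "arr g" "src g = X" "tgt g = A"
    and eq: "W \<I> f (tpow A k) \<cdot> aps k = W \<I> g (tpow A k) \<cdot> aps k"
  shows "f = g"
proof -
  let ?P = "tpow A k" let ?Q = "dpow k"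
  have *: "W X (cvs k) \<I> \<cdot> W \<I> (W \<I> h ?P \<cdot> aps k) ?Q = h \<cdot> pss k"
    if "arr h" "src h = X" "tgt h = A" "X \<in> obj C" for h
  proof -
    have "W X (cvs k) \<I> \<cdot> W \<I> (W \<I> h ?P \<cdot> aps k) ?Q
      = W X (cvs k) \<I> \<cdot> W \<I> h (?P \<odot> ?Q) \<cdot> W \<I> (pss k) (?P \<odot> ?Q) \<cdot> W A (cns k) ?Q"
      using that by (simp flip: pss_cns)
    also have "\<dots> = h \<cdot> W A (cvs k) \<I> \<cdot> W \<I> (pss k) (?P \<odot> ?Q) \<cdot> W A (cns k) ?Q"
      using that interchange_post[of h "cvs k" \<I> \<I> \<I> "W \<I> (pss k) (?P \<odot> ?Q) \<cdot> W A (cns k) ?Q"]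
      by simp
    also have "\<dots> = h \<cdot> pss k \<cdot> W (A \<odot> ?Q) (cvs k) \<I> \<cdot> W A (cns k) ?Q"
      using that interchange_post[of "pss k" "cvs k" \<I> \<I> \<I> "W A (cns k) ?Q"] by simp
    also have "\<dots> = h \<cdot> pss k"
      using that arg_cong[OF snakes_right[of k], of "\<lambda>f. W A f \<I>"] by simp
    finally show ?thesis .
  qed
  have "X \<in> obj C" using arr_src[OF f(1)] f(2) by simp
  then have "f \<cdot> pss k = g \<cdot> pss k"
    using *[of f] *[of g] f g eq by simp
  then have "(f \<cdot> pss k) \<cdot> phs k = (g \<cdot> pss k) \<cdot> phs k"
    by simp
  then show ?thesis using f g by simp
qed

section \<open>Bundled arrows compared with the original definitions\<close>

lemma ap_eq: "ap = (A \<odot> A, app, A)"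
proof -
  have "ap = (A \<odot> A, mor ap, A)"
    by (intro triple_eqI) simp_all
  also have "mor ap = app"
    unfolding ap_def app_def by (simp add: W_left W_right comp_def) (simp add: ps_def cn_def)
  finally show ?thesis .
qed

lemma lm_eq: "lm = (A, lam, A \<odot> A)"
proof -
  have "lm = ((W A (cv A) \<I> \<cdot> W (A \<odot> A) (twi D) \<I>) \<cdot> W A (bri D A) \<I>) \<cdot> W \<I> ph A"
    by (simp add: lm_def cv'_def)
  moreover have "\<one> (A \<odot> A) \<otimes> mor (twi D) = \<one> A \<otimes> \<one> A \<otimes> mor (twi D)"
    using tarr_assoc[of A A A A D D "\<one> A" "\<one> A" "mor (twi D)"] arr_mor[of "twi D"]
    by (simp add: ident_hom tarr_ident)
  ultimately show ?thesis
    unfolding lam_def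
    by (simp add: W_left W_right comp_def del: comp_assoc) (simp add: ph_def cv_def twi_def bri_def)
qed


lemma mor_lm: "mor lm = lam"
  by (simp add: lm_eq)

lemma aps_eq: "aps k = (A \<odot> tpow A k, apps k, A)"
proof (induction k)
  case (Suc k)
  then have "mor (aps k) = apps k" by simp
  then have "mor (aps (Suc k)) = apps (Suc k)"
    by (simp add: W_left comp_def) (simp add: ap_eq)
  then show ?case by (intro triple_eqI) simp_all
qed (simp add: idt_def)

lemma lms_triple: "lms k = (A, lams k, A \<odot> tpow A k)"
proof (induction k)
  case (Suc k)
  then have "mor (lms k) = lams k" by simp
  then have "mor (lms (Suc k)) = lams (Suc k)"
    by (simp add: W_left comp_def) (simp add: lm_eq)
  then show ?case by (intro triple_eqI) simp_all
qed (simp add: idt_def)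

lemma tr_eq: "\<lbrakk>arr f; src f = A; tgt f = A \<odot> A\<rbrakk> \<Longrightarrow> tr f = (\<I>, trace \<I> A A (mor f), A)"
  using trace_triple[of f \<I> A A] by (simp add: tr_def cn'_def)

section \<open>Elements and their operators\<close>

definition el :: "'m \<Rightarrow> 'o \<times> 'm \<times> 'o" where
  "el a = (\<I>, a, A)"

definition op :: "'m \<Rightarrow> 'o \<times> 'm \<times> 'o" where
  "op a = W \<I> (el a) A \<cdot> ap"

lemma el_simps [simp]: "src (el a) = \<I>" "tgt (el a) = A" "a \<in> hom C \<I> A \<Longrightarrow> arr (el a)"
  by (simp_all add: el_def arr_triple)

lemma op_simps [simp]: "src (op a) = A" "tgt (op a) = A" "a \<in> hom C \<I> A \<Longrightarrow> arr (op a)"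
  by (simp_all add: op_def)

lemma el_F:
  assumes f: "arr f" "src f = tpow A m" "tgt f = tpow A n"
  shows "el (F m n (mor f)) =
    cvs (Suc m) \<cdot> W \<I> (W A f \<I> \<cdot> aps n) (dpow (Suc m)) \<cdot> phs (Suc m)"
proof -
  let ?t = "(lms m \<cdot> (W \<I> lm (tpow A m) \<cdot> W (A \<odot> A) f \<I>)) \<cdot> W A (aps n) \<I>"
  have "mor (W \<I> lm (tpow A m) \<cdot> W (A \<odot> A) f \<I>) = lam \<otimes> mor f"
    using arg_cong[OF tensor_W(1)[of lm f], of mor] f by (simp add: mor_lm)
  then have "mor ?t = lams m ;; (lam \<otimes> mor f) ;; (\<one> A \<otimes> apps n)"
    by (simp add: comp_def W_right) (simp add: lms_triple aps_eq)
  then have "el (F m n (mor f)) = tr ?t"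
    using f by (simp add: tr_eq el_def F_def)
  \<comment> \<open>The \<open>lam\<close> placed beside \<open>f\<close> completes
    \<open>lams m\<close> to \<open>lams (m + 1)\<close>; the additional argument is the first
    factor of \<open>A \<otimes> f\<close>.\<close>
  also have "\<dots> = tr (lms (Suc m) \<cdot> W A (W A f \<I> \<cdot> aps n) \<I>)"
    using f by simp
  also have "\<dots> = cvs (Suc m) \<cdot> W \<I> (W A f \<I> \<cdot> aps n) (dpow (Suc m)) \<cdot> phs (Suc m)"
    using f by (intro tr_lms) simp_all
  finally show ?thesis .
qed

lemma F_hom:
  assumes "f \<in> hom C (tpow A m) (tpow A n)"
  shows "F m n f \<in> hom C \<I> A"
proof -
  have "arr (el (F m n (mor (tpow A m, f, tpow A n))))"
    using assms by (subst el_F) (simp_all add: arr_triple)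
  then show ?thesis by (simp add: arr_triple el_def)
qed

text \<open>Undoes by \<open>uncurry\<close> the currying of \<open>m + 1\<close> arguments in
  \<open>el_F\<close>; the first of them is the argument of \<open>op\<close>. Besides typing, this
  is the only property of \<open>F\<close> used from here on.\<close>

lemma op_F:
  assumes "f \<in> hom C (tpow A m) (tpow A n)"
  shows "W \<I> (op (F m n f)) (tpow A m) \<cdot> aps m = W A (tpow A m, f, tpow A n) \<I> \<cdot> aps n"
proof -
  let ?f = "(tpow A m, f, tpow A n)"
  have "W \<I> (el (F m n (mor ?f))) (tpow A (Suc m)) \<cdot> aps (Suc m) = W A ?f \<I> \<cdot> aps n"
    using assms uncurry[of "W A ?f \<I> \<cdot> aps n" \<I> "Suc m"]
    by (subst el_F) (simp_all add: arr_triple)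
  then show ?thesis
    using F_hom[OF assms] by (simp add: op_def)
qed

lemma op_inject:
  assumes "a \<in> hom C \<I> A" "b \<in> hom C \<I> A" "op a = op b"
  shows "a = b"
proof -
  have "el a = el b"
    using assms aps_extensional[of "el a" \<I> "el b" 1] by (simp add: op_def)
  then show ?thesis by (simp add: el_def)
qed

lemma el_appl:
  assumes "a \<in> hom C \<I> A" "b \<in> hom C \<I> A"
  shows "el (a \<bullet> b) = el b \<cdot> op a"
proof -
  have "el (a \<bullet> b) = (\<I>, a \<otimes> b, A \<odot> A) \<cdot> ap"
    by (simp add: el_def appl_def ap_eq comp_def)
  also have "(\<I>, a \<otimes> b, A \<odot> A) = el b \<cdot> W \<I> (el a) A"
    using assms tensor_W(2)[of "el a" "el b"] by simp (simp add: el_def)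
  finally show ?thesis using assms by (simp add: op_def)
qed

lemma appl_hom [simp]:
  assumes "a \<in> hom C \<I> A" "b \<in> hom C \<I> A"
  shows "a \<bullet> b \<in> hom C \<I> A"
proof -
  have "arr (el (a \<bullet> b))" using assms by (simp add: el_appl)
  then show ?thesis by (simp add: el_def arr_triple)
qed

lemma op_appl:
  assumes "a \<in> hom C \<I> A" "b \<in> hom C \<I> A"
  shows "op (a \<bullet> b) = W \<I> (el b) A \<cdot> W \<I> (op a) A \<cdot> ap"
  using assms by (simp add: op_def[of "a \<bullet> b"] el_appl)

section \<open>The laws of the combinators\<close>

lemma app_hom: "app \<in> hom C (tpow A 2) (tpow A 1)"
  using ap_lm(3) by (simp add: ap_eq arr_triple numeral_2_eq_2)

lemma braid_hom: "\<sigma> A A \<in> hom C (tpow A 2) (tpow A 2)"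
  using br_bri(1)[of A A] by (simp add: br_def arr_triple numeral_2_eq_2)

lemma combs_hom [simp]:
  "combB \<in> hom C \<I> A" "combC \<in> hom C \<I> A" "combI \<in> hom C \<I> A"
  unfolding combB_def combC_def combI_def
  by (rule F_hom[OF app_hom], rule F_hom[OF braid_hom], rule F_hom) (simp add: ident_hom)

text \<open>In element form \<open>B x y z = x (y z)\<close>. The next two lemmas are likewise the
  laws of \<open>combC\<close>, with the exchange done by the braid, and of
  \<open>combI\<close>.\<close>

lemma op_B: "W \<I> (op combB) (A \<odot> A) \<cdot> W \<I> ap A \<cdot> ap = W A ap \<I> \<cdot> ap"
  using op_F[OF app_hom] by (simp add: combB_def numeral_2_eq_2 ap_eq[symmetric])

lemma op_C: "W \<I> (op combC) (A \<odot> A) \<cdot> W \<I> ap A \<cdot> ap = W A (br A A) \<I> \<cdot> W \<I> ap A \<cdot> ap"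
  using op_F[OF braid_hom] by (simp add: combC_def numeral_2_eq_2 br_def[symmetric])

lemma op_I [simp]: "op combI = idt A"
  using op_F[of "\<one> \<I>" 0 0] F_hom[of "\<one> \<I>" 0 0]
  by (simp add: combI_def ident_hom idt_def[symmetric])

lemma compos_hom [simp]: "\<lbrakk>a \<in> hom C \<I> A; b \<in> hom C \<I> A\<rbrakk> \<Longrightarrow> compos a b \<in> hom C \<I> A"
  by (simp add: compos_def)

lemma op_appl2:
  assumes "c \<in> hom C \<I> A" "a \<in> hom C \<I> A" "b \<in> hom C \<I> A"
  shows "op (c \<bullet> a \<bullet> b) =
    W \<I> (el b) A \<cdot> W \<I> (el a) (A \<odot> A) \<cdot> W \<I> (op c) (A \<odot> A) \<cdot> W \<I> ap A \<cdot> ap"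
  using assms by (simp add: op_appl)

lemma op_compos:
  assumes "a \<in> hom C \<I> A" "b \<in> hom C \<I> A"
  shows "op (compos a b) = op b \<cdot> op a"
  using assms interchange_post[of "el a" ap \<I> \<I> \<I> ap]
  by (simp add: compos_def op_appl2 op_B) (simp add: op_def)

text \<open>In element form \<open>bul a x = x a\<close>. The braid of \<open>combC\<close>
  disappears by naturality because \<open>el a\<close> starts at \<I>.\<close>

lemma op_bul:
  assumes "a \<in> hom C \<I> A"
  shows "op (bul a) = W A (el a) \<I> \<cdot> ap"
proof -
  have "op (bul a) = W \<I> (el a) A \<cdot> W \<I> (el combI) (A \<odot> A) \<cdot> W A (br A A) \<I> \<cdot> W \<I> ap A \<cdot> ap"
    using assms by (simp add: bul_def op_appl2 op_C)
  also have "\<dots> = W \<I> (el a) A \<cdot> br A A \<cdot> W \<I> (op combI) A \<cdot> ap"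
    using assms interchange_post[of "el combI" "br A A" \<I> \<I> \<I> "W \<I> ap A \<cdot> ap"]
    by (simp add: op_def del: op_I)
  also have "\<dots> = W A (el a) \<I> \<cdot> ap"
    using assms comp_post[OF br_natural_left[of "el a" A], of ap] by simp
  finally show ?thesis .
qed

lemma bul_hom [simp]: "a \<in> hom C \<I> A \<Longrightarrow> bul a \<in> hom C \<I> A"
  by (simp add: bul_def)

section \<open>Iterates of \<open>combB\<close> and the arity equation\<close>

lemma iter_hom [simp]: "iter combB k \<in> hom C \<I> A"
  by (induction k) simp_all

text \<open>As \<open>op\<close> reverses composition, \<open>iter combB (Suc k)\<close> sends
  \<open>x\<close> to \<open>B (iter combB k x)\<close>. The outer \<open>B\<close> groups the
  second argument with the third, and the induction hypothesis absorbs the others.\<close>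

lemma op_iter_B:
  "W \<I> (op (iter combB k)) (A \<odot> tpow A k) \<cdot> W \<I> ap (tpow A k) \<cdot> aps k = W A (aps k) \<I> \<cdot> ap"
proof (induction k)
  case (Suc k)
  let ?P = "tpow A k"
  let ?b = "op (iter combB k)"
  have "W \<I> (op (iter combB (Suc k))) (A \<odot> tpow A (Suc k)) \<cdot> W \<I> ap (tpow A (Suc k)) \<cdot> aps (Suc k)
    = W \<I> ?b (A \<odot> A \<odot> ?P) \<cdot> W \<I> (W \<I> (op combB) (A \<odot> A) \<cdot> W \<I> ap A \<cdot> ap) ?P \<cdot> aps k"
    by (simp add: op_compos)
  also have "\<dots> = W A ap ?P \<cdot> W \<I> ?b (A \<odot> ?P) \<cdot> W \<I> ap ?P \<cdot> aps k"
    unfolding op_B using interchange_post[of ?b ap \<I> \<I> ?P "W \<I> ap ?P \<cdot> aps k"] by simp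
  also have "\<dots> = W A (aps (Suc k)) \<I> \<cdot> ap"
    unfolding Suc by simp
  finally show ?case .
qed simp

text \<open>\<open>papp n\<close> sends \<open>(x, b)\<close> to the element \<open>p\<close> with \<open>p c\<^sub>1 \<dots> c\<^sub>n = x (b c\<^sub>1 \<dots> c\<^sub>n)\<close>.\<close>

definition papp :: "nat \<Rightarrow> 'o \<times> 'm \<times> 'o" where
  "papp n = W \<I> (op (iter combB n)) A \<cdot> ap"

lemma papp_simps [simp]: "arr (papp n)" "src (papp n) = A \<odot> A" "tgt (papp n) = A"
  by (simp_all add: papp_def)

lemma papp_aps: "W \<I> (papp n) (tpow A n) \<cdot> aps n = W A (aps n) \<I> \<cdot> ap"
  using op_iter_B[of n] by (simp add: papp_def)

text \<open>Both elements are applied to \<open>x\<close>, \<open>y\<close> and \<open>m\<close>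
  further arguments \<open>c\<close>. Since \<open>bul a\<close> applies its argument to
  \<open>a\<close>, the left one gives \<open>x (h y c)\<close>; the right one gives
  \<open>h (papp n x y) c\<close>. Nothing is lost, by \<open>op_inject\<close> and
  \<open>aps_extensional\<close>.\<close>

lemma has_arity_iff:
  fixes m n :: nat
  assumes a: "a \<in> hom C \<I> A"
  defines "h \<equiv> W \<I> (op a) (tpow A m) \<cdot> aps m"
  shows "has_arity a m n \<longleftrightarrow> W \<I> (papp n) (tpow A m) \<cdot> h = W A h \<I> \<cdot> ap"
proof -
  let ?P = "tpow A m"
  let ?l = "compos (bul a) (iter combB (Suc m))" and ?r = "compos (combB \<bullet> a) (iter combB n)"
  have l: "W \<I> (op ?l) (A \<odot> ?P) \<cdot> aps (Suc m) = W A h \<I> \<cdot> ap"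
  proof -
    have "W \<I> (op ?l) (A \<odot> ?P) \<cdot> aps (Suc m)
      = W \<I> (op (iter combB (Suc m))) (A \<odot> ?P) \<cdot> W A (el a) (A \<odot> ?P) \<cdot> W \<I> ap (A \<odot> ?P) \<cdot> aps (Suc m)"
      using a by (simp add: op_compos[of "bul a"] op_bul del: iter.simps)
    also have "\<dots> = W A (el a) (A \<odot> ?P) \<cdot> W \<I> (op (iter combB (Suc m))) (A \<odot> A \<odot> ?P) \<cdot> W \<I> ap (A \<odot> ?P) \<cdot> aps (Suc m)"
      using a interchange_post[of "op (iter combB (Suc m))" "el a" \<I> \<I> "A \<odot> ?P" "W \<I> ap (A \<odot> ?P) \<cdot> aps (Suc m)"]
      by (simp del: iter.simps)
    also have "\<dots> = W A (el a) (A \<odot> ?P) \<cdot> W A (aps (Suc m)) \<I> \<cdot> ap"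
      using op_iter_B[of "Suc m"] by (simp del: iter.simps)
    finally show ?thesis using a by (simp add: h_def op_def)
  qed
  have r: "W \<I> (op ?r) (A \<odot> ?P) \<cdot> aps (Suc m) = W \<I> (papp n) ?P \<cdot> h"
  proof -
    let ?b = "W \<I> (op (iter combB n)) (A \<odot> ?P)"
    have "W \<I> (op ?r) (A \<odot> ?P) \<cdot> aps (Suc m)
      = ?b \<cdot> W \<I> (el a) (A \<odot> A \<odot> ?P) \<cdot> W \<I> (W \<I> (op combB) (A \<odot> A) \<cdot> W \<I> ap A \<cdot> ap) ?P \<cdot> aps m"
      using a by (simp add: op_compos op_appl)
    also have "\<dots> = ?b \<cdot> W \<I> ap ?P \<cdot> W \<I> (el a) (A \<odot> ?P) \<cdot> W \<I> ap ?P \<cdot> aps m"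
      unfolding op_B using a interchange_post[of "el a" ap \<I> \<I> ?P "W \<I> ap ?P \<cdot> aps m"] by simp
    finally show ?thesis using a by (simp add: h_def papp_def op_def)
  qed
  have "has_arity a m n \<longleftrightarrow> op ?l = op ?r"
    unfolding has_arity_def using a op_inject[of ?l ?r] by (auto simp del: iter.simps)
  also have "\<dots> \<longleftrightarrow> W \<I> (op ?l) (A \<odot> ?P) \<cdot> aps (Suc m) = W \<I> (op ?r) (A \<odot> ?P) \<cdot> aps (Suc m)"
    using a aps_extensional[of "op ?l" A "op ?r" "Suc m"] by (auto simp del: iter.simps aps.simps)
  finally show ?thesis unfolding l r by auto
qed

text \<open>Here \<open>h\<close> is \<open>A \<otimes> f\<close> followed by \<open>aps n\<close>.
  As \<open>papp n\<close> stays clear of the strands of \<open>f\<close>, it slides past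
  \<open>f\<close> and meets \<open>aps n\<close>, where \<open>papp_aps\<close> turns it into the
  outer application.\<close>

lemma F_has_arity:
  assumes f: "f \<in> hom C (tpow A m) (tpow A n)"
  shows "has_arity (F m n f) m n"
proof -
  let ?f = "(tpow A m, f, tpow A n)"
  have [simp]: "arr ?f" using f by (simp add: arr_triple)
  have "W \<I> (papp n) (tpow A m) \<cdot> W A ?f \<I> \<cdot> aps n = W (A \<odot> A) ?f \<I> \<cdot> W \<I> (papp n) (tpow A n) \<cdot> aps n"
    using interchange_post[of "papp n" ?f \<I> \<I> \<I> "aps n"] by simp
  then show ?thesis
    by (simp add: has_arity_iff F_hom[OF f] op_F[OF f] papp_aps)
qed

section \<open>Functor laws for \<open>F\<close>\<close>

lemma eq_F_iff:
  assumes "a \<in> hom C \<I> A" "f \<in> hom C (tpow A m) (tpow A n)"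
  shows "a = F m n f \<longleftrightarrow> W \<I> (op a) (tpow A m) \<cdot> aps m = W A (tpow A m, f, tpow A n) \<I> \<cdot> aps n"
  using assms op_F[OF assms(2)] F_hom[OF assms(2)] op_inject[of a "F m n f"]
    aps_extensional[of "op a" A "op (F m n f)" m] by auto

lemma F_ident: "F m m (\<one> (tpow A m)) = combI"
  using eq_F_iff[of combI "\<one> (tpow A m)" m m] by (simp add: ident_hom flip: idt_def)

lemma F_seq:
  assumes f: "f \<in> hom C (tpow A l) (tpow A m)" and g: "g \<in> hom C (tpow A m) (tpow A n)"
  shows "F l n (f ;; g) = compos (F l m f) (F m n g)"
proof -
  let ?f = "(tpow A l, f, tpow A m)" and ?g = "(tpow A m, g, tpow A n)"
  have [simp]: "arr ?f" "arr ?g" using f g by (simp_all add: arr_triple)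
  have "W \<I> (op (compos (F l m f) (F m n g))) (tpow A l) \<cdot> aps l
    = W \<I> (op (F m n g)) (tpow A l) \<cdot> W \<I> (op (F l m f)) (tpow A l) \<cdot> aps l"
    using f g by (simp add: op_compos F_hom)
  also have "\<dots> = W A ?f \<I> \<cdot> W \<I> (op (F m n g)) (tpow A m) \<cdot> aps m"
    unfolding op_F[OF f] using interchange_post[of "op (F m n g)" ?f \<I> \<I> \<I> "aps m"] F_hom[OF g] by simp
  also have "\<dots> = W A (?f \<cdot> ?g) \<I> \<cdot> aps n"
    unfolding op_F[OF g] by simp
  finally show ?thesis
    using eq_F_iff[of "compos (F l m f) (F m n g)" "f ;; g" l n] f g
    by (simp add: F_hom comp_def seq_hom[of "tpow A l" "tpow A m" "tpow A n"])
qed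

section \<open>The loop of value one: cancellation and fullness\<close>

context
  assumes loop: "trace \<I> \<I> A (\<one> A) = \<one> \<I>"
begin

text \<open>The loop \<open>trace \<I> \<I> A (\<one> A)\<close> cut open just before its final
  \<open>cn A\<close>; it is also \<open>R A D (cv A)\<close>.\<close>

definition lp :: "'o \<times> 'm \<times> 'o" where
  "lp = cv A \<cdot> br A D \<cdot> W D (tw A) \<I>"

lemma lp_simps [simp]: "arr lp" "src lp = \<I>" "tgt lp = D \<odot> A"
  by (simp_all add: lp_def)

lemma lp_cn [simp]: "lp \<cdot> cn A = idt \<I>"
  using trace_triple[of "idt A" \<I> A \<I>] loop by (simp add: lp_def mor_idt idt_def[of \<I>])

text \<open>This is where the dimension hypothesis enters: the closed loop \<open>lp \<cdot> cn A\<close> can be created freely.\<close>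

lemma W_A_inject:
  assumes f: "arr f" and g: "arr g" and "src f = src g" "tgt f = tgt g" and eq: "W A f \<I> = W A g \<I>"
  shows "f = g"
proof -
  have *: "W \<I> lp (src h) \<cdot> W D (W A h \<I>) \<I> \<cdot> W \<I> (cn A) (tgt h) = h" if "arr h" for h
    using that interchange[of "cn A" h \<I> \<I> \<I>] W_cancel_post[of lp "cn A" \<I> "src h" h] by simp
  show ?thesis using *[OF f] *[OF g] assms by simp
qed

text \<open>Counterpart of \<open>aps_extensional\<close> for the arguments instead of the head.
  Unfolding the head by \<open>phs n\<close> leaves an idle strand \<open>A\<close>, which
  \<open>W_A_inject\<close> removes; the nested snakes then recover the arguments.\<close>

lemma aps_cancel:
  assumes f: "arr f" "src f = X" "tgt f = tpow A n" and g: "arr g" "src g = X" "tgt g = tpow A n"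
    and eq: "W A f \<I> \<cdot> aps n = W A g \<I> \<cdot> aps n"
  shows "f = g"
proof -
  let ?P = "tpow A n" let ?Q = "dpow n"
  have X: "X \<in> obj C" using arr_src[OF f(1)] f(2) by simp
  have 1: "W \<I> (phs n) X \<cdot> W A h \<I> \<cdot> aps n = W A (W ?Q h \<I> \<cdot> cns n) \<I>"
    and 2: "W \<I> (cvs n) X \<cdot> W ?P (W ?Q h \<I> \<cdot> cns n) \<I> = h"
    if "arr h" "src h = X" "tgt h = ?P" for h
  proof -
    show "W \<I> (phs n) X \<cdot> W A h \<I> \<cdot> aps n = W A (W ?Q h \<I> \<cdot> cns n) \<I>"
      using that X interchange_post[of "phs n" h \<I> \<I> \<I> "aps n"] by (simp add: phs_aps)
    show "W \<I> (cvs n) X \<cdot> W ?P (W ?Q h \<I> \<cdot> cns n) \<I> = h"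
      using that X interchange_post[of "cvs n" h \<I> \<I> \<I> "W ?P (cns n) \<I>"] by (simp add: snakes_left)
  qed
  have "W A (W ?Q f \<I> \<cdot> cns n) \<I> = W A (W ?Q g \<I> \<cdot> cns n) \<I>"
    unfolding 1[OF f, symmetric] 1[OF g, symmetric] eq ..
  then have "W ?Q f \<I> \<cdot> cns n = W ?Q g \<I> \<cdot> cns n"
    by (rule W_A_inject[rotated 4]) (use f g in simp_all)
  then have "W \<I> (cvs n) X \<cdot> W ?P (W ?Q f \<I> \<cdot> cns n) \<I> = W \<I> (cvs n) X \<cdot> W ?P (W ?Q g \<I> \<cdot> cns n) \<I>"
    by (rule arg_cong)
  then show ?thesis unfolding 2[OF f] 2[OF g] .
qed

lemma F_full:
  assumes a: "a \<in> hom C \<I> A" and arity: "has_arity a m n"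
  shows "\<exists>f \<in> hom C (tpow A m) (tpow A n). F m n f = a"
proof -
  let ?P = "tpow A m" let ?R = "tpow A n" let ?Q = "dpow n"
  define h where "h = W \<I> (op a) ?P \<cdot> aps m"
  have h [simp]: "arr h" "src h = A \<odot> ?P" "tgt h = A"
    using a by (simp_all add: h_def)
  have ar: "W \<I> (papp n) ?P \<cdot> h = W A h \<I> \<cdot> ap"
    using has_arity_iff[OF a] arity by (simp add: h_def)
  \<comment> \<open>Once \<phi> writes the first argument of \<open>papp n\<close> as
    \<open>A \<odot> D\<close>, the factor \<open>A\<close> passes through and \<open>q\<close> acts
    on \<open>D\<close> and the second argument. The loop makes \<open>s\<close> a section of
    \<open>q\<close>.\<close>
  define q where "q = W D (pss n) \<I> \<cdot> W \<I> (cn A) ?Q"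
  define s where "s = W \<I> lp ?Q \<cdot> W D (phs n) \<I>"
  \<comment> \<open>\<open>w\<close> is the value that \<open>s\<close> extracts from the right side
    of the arity equation; \<open>f\<close> is \<open>w\<close> with its \<open>dpow n\<close>
    inputs bent into outputs.\<close>
  define w where "w = W \<I> s ?P \<cdot> W D h \<I> \<cdot> cn A"
  define f where "f = W \<I> (cvs n) ?P \<cdot> W ?R w \<I>"
  have [simp]: "arr q" "src q = D \<odot> A" "tgt q = ?Q" "arr s" "src s = ?Q" "tgt s = D \<odot> A"
    by (simp_all add: q_def s_def)
  have [simp]: "arr w" "src w = ?Q \<odot> ?P" "tgt w = \<I>"
    by (simp_all add: w_def)
  have [simp]: "arr f" "src f = ?P" "tgt f = ?R"
    by (simp_all add: f_def)
  have ph_ap: "W \<I> ph A \<cdot> ap = W A (cn A) \<I>"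
    by (simp add: ap_def W_cancel_post)
  have sq: "s \<cdot> q = idt ?Q"
    using W_cancel_post[of "phs n" "pss n" D \<I> "W \<I> (cn A) ?Q"] W_cancel[of lp "cn A" \<I> ?Q]
    by (simp add: s_def q_def)
  \<comment> \<open>The sides are compared after application to \<open>n\<close> arguments, since
    \<open>papp_aps\<close> describes \<open>papp n\<close> in that form.\<close>
  have q_phs: "W \<I> ph A \<cdot> papp n = W A q \<I> \<cdot> phs n"
  proof (rule aps_extensional[of _ "A \<odot> D \<odot> A" _ n])
    have "W \<I> (W \<I> ph A \<cdot> papp n) ?R \<cdot> aps n = W \<I> ph (A \<odot> ?R) \<cdot> W A (aps n) \<I> \<cdot> ap"
      by (simp add: papp_aps)
    also have "\<dots> = W (A \<odot> D) (aps n) \<I> \<cdot> W A (cn A) \<I>"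
      using interchange_post[of ph "aps n" \<I> \<I> \<I> ap] by (simp add: ph_ap)
    also have "\<dots> = W A (W D (W \<I> (pss n) ?R \<cdot> W A (cns n) \<I>) \<I> \<cdot> cn A) \<I>"
      by (simp add: pss_cns)
    also have "\<dots> = W (A \<odot> D) (pss n) ?R \<cdot> W (A \<odot> D \<odot> A) (cns n) \<I> \<cdot> W A (cn A) \<I>"
      by simp
    also have "\<dots> = W (A \<odot> D) (pss n) ?R \<cdot> W A (cn A) (?Q \<odot> ?R) \<cdot> W A (cns n) \<I>"
      using interchange[of "cn A" "cns n" A \<I> \<I>] by simp
    finally show "W \<I> (W \<I> ph A \<cdot> papp n) ?R \<cdot> aps n = W \<I> (W A q \<I> \<cdot> phs n) ?R \<cdot> aps n"
      by (simp add: q_def phs_aps)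
  qed simp_all
  \<comment> \<open>Precomposing the arity equation with \<phi> puts \<open>q\<close> on the left
    and a bare strand \<open>A\<close> on the right; precomposing with \<open>s\<close> then cancels
    \<open>q\<close>.\<close>
  have u: "W \<I> (phs n) ?P \<cdot> h = W A w \<I>"
  proof -
    have "W A q ?P \<cdot> W \<I> (phs n) ?P \<cdot> h = W \<I> (W \<I> ph A \<cdot> papp n) ?P \<cdot> h"
      by (simp add: q_phs)
    also have "\<dots> = W \<I> ph (A \<odot> ?P) \<cdot> W A h \<I> \<cdot> ap"
      by (simp add: ar)
    also have "\<dots> = W (A \<odot> D) h \<I> \<cdot> W A (cn A) \<I>"
      using interchange_post[of ph h \<I> \<I> \<I> ap] by (simp add: ph_ap)
    finally have "W A s ?P \<cdot> W A q ?P \<cdot> W \<I> (phs n) ?P \<cdot> h = W A w \<I>"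
      by (simp add: w_def)
    then show ?thesis
      using W_cancel_post[of s q A ?P "W \<I> (phs n) ?P \<cdot> h"] sq by simp
  qed
  have f_w: "W ?Q f \<I> \<cdot> cns n = w"
  proof -
    have "W ?Q f \<I> \<cdot> cns n = W ?Q (cvs n) ?P \<cdot> W \<I> (cns n) (?Q \<odot> ?P) \<cdot> w"
      using interchange[of "cns n" w \<I> \<I> \<I>] by (simp add: f_def)
    also have "\<dots> = w"
      using comp_post[of "W ?Q (cvs n) ?P" "W \<I> (cns n) (?Q \<odot> ?P)" "idt (?Q \<odot> ?P)" w]
        arg_cong[OF snakes_right[of n], of "\<lambda>h. W \<I> h ?P"] by simp
    finally show ?thesis .
  qed
  have "h = W \<I> (pss n) ?P \<cdot> W \<I> (phs n) ?P \<cdot> h"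
    using W_cancel_post[of "pss n" "phs n" \<I> ?P h] by simp
  also have "\<dots> = W \<I> (pss n) ?P \<cdot> W (A \<odot> ?Q) f \<I> \<cdot> W A (cns n) \<I>"
    using arg_cong[OF f_w, of "\<lambda>h. W A h \<I>"] by (simp add: u)
  also have "\<dots> = W A f \<I> \<cdot> W \<I> (pss n) ?R \<cdot> W A (cns n) \<I>"
    using interchange_post[of "pss n" f \<I> \<I> \<I> "W A (cns n) \<I>"] by simp
  also have "\<dots> = W A f \<I> \<cdot> aps n"
    by (simp add: pss_cns)
  finally have "W \<I> (op a) ?P \<cdot> aps m = W A (?P, mor f, ?R) \<I> \<cdot> aps n"
    by (simp add: h_def f_def comp_def)
  moreover have "mor f \<in> hom C ?P ?R"
    using arr_mor[of f] by simp
  ultimately show ?thesis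
    using eq_F_iff[OF a] by metis
qed

section \<open>The two categories and the equivalence\<close>

lemma category_powers_subcat: "category powers_subcat"
proof
qed (auto simp: powers_subcat_def full_subcat_def
  intro: ident_hom seq_hom[OF tpow_obj tpow_obj tpow_obj] ident_seq[OF tpow_obj tpow_obj] 
    seq_ident[OF tpow_obj tpow_obj] seq_assoc[OF tpow_obj tpow_obj tpow_obj tpow_obj])

text \<open>Closure of arities under composition is not computed from the arity equation: by
  fullness both elements are values of \<open>F\<close>, so by \<open>F_seq\<close> their composite
  is one too. The remaining laws hold already for operators.\<close>

lemma category_internal_PROB: "category internal_PROB"
proof
  fix l m n a b
  assume a: "a \<in> hom internal_PROB l m" and b: "b \<in> hom internal_PROB m n"
  obtain f g where f: "f \<in> hom C (tpow A l) (tpow A m)" "F l m f = a"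
    and g: "g \<in> hom C (tpow A m) (tpow A n)" "F m n g = b"
    using F_full[of a l m] F_full[of b m n] a b by (auto simp: internal_PROB_def)
  have "f ;; g \<in> hom C (tpow A l) (tpow A n)"
    using f g by (intro seq_hom[of _ "tpow A m"]) simp_all
  then show "a ;;\<^bsub>internal_PROB\<^esub> b \<in> hom internal_PROB l n"
    using F_hom[of "f ;; g" l n] F_has_arity[of "f ;; g" l n] F_seq[OF f(1) g(1)] f(2) g(2)
    by (auto simp: internal_PROB_def)
next
  fix m
  show "\<one>\<^bsub>internal_PROB\<^esub> m \<in> hom internal_PROB m m"
    using F_has_arity[OF ident_hom, of m] F_ident[of m] by (simp add: internal_PROB_def)
qed (auto simp: internal_PROB_def op_compos intro!: op_inject)

lemma F_functor: "is_functor powers_subcat internal_PROB (\<lambda>m. m) F"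
  using category_powers_subcat category_internal_PROB
  by (auto simp: is_functor_def powers_subcat_def full_subcat_def internal_PROB_def
      F_hom F_has_arity F_ident F_seq)

lemma F_is_full: "is_full powers_subcat internal_PROB (\<lambda>m. m) F"
  using F_full by (simp add: is_full_def powers_subcat_def full_subcat_def internal_PROB_def)

lemma F_is_faithful: "is_faithful powers_subcat F"
  unfolding is_faithful_def
proof (intro ballI inj_onI)
  fix m n f g
  assume "f \<in> hom powers_subcat m n" "g \<in> hom powers_subcat m n" and eq: "F m n f = F m n g"
  then have f: "f \<in> hom C (tpow A m) (tpow A n)" and g: "g \<in> hom C (tpow A m) (tpow A n)"
    by (simp_all add: powers_subcat_def full_subcat_def)
  have "(tpow A m, f, tpow A n) = (tpow A m, g, tpow A n)"
    by (rule aps_cancel[where X = "tpow A m" and n = n])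
      (use op_F[OF f] op_F[OF g] eq f g in \<open>simp_all add: arr_triple\<close>)
  then show "f = g" by simp
qed

lemma F_is_equivalence: "is_equivalence powers_subcat internal_PROB (\<lambda>m. m) F"
  using F_functor F_is_full F_is_faithful
  by (intro identity_on_objects_equivalence)
    (simp_all add: powers_subcat_def full_subcat_def internal_PROB_def)

end

end

theorem theorem6p10:
  fixes C :: "('o, 'm, 'z) ribbon_scheme" and A :: 'o and \<phi> :: 'm
  assumes "reflexive_object C A \<phi>"
    and "ribbon_category.trace C (tunit C) (tunit C) A (ident C A) = ident C (tunit C)"
  shows "is_functor (reflexive_object.powers_subcat C A) (reflexive_object.internal_PROB C A \<phi>)
           (\<lambda>m. m) (reflexive_object.F C A \<phi>) \<and>
         is_full (reflexive_object.powers_subcat C A) (reflexive_object.internal_PROB C A \<phi>)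
           (\<lambda>m. m) (reflexive_object.F C A \<phi>) \<and>
         is_faithful (reflexive_object.powers_subcat C A) (reflexive_object.F C A \<phi>) \<and>
         is_equivalence (reflexive_object.powers_subcat C A)
           (reflexive_object.internal_PROB C A \<phi>) (\<lambda>m. m) (reflexive_object.F C A \<phi>)"
proof -
  interpret reflexive_object C A \<phi> by (rule assms(1))
  show ?thesis
    using F_functor F_is_full F_is_faithful F_is_equivalence assms(2) by blast
qed

end
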